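(* Let $n\ge2$, and let the functions $I_{i,j}$ be the coefficients of the tensors $\Theta_k$ with respect to the invariant coframe $\omega_1,\omega_2$, $$\Theta_k=\sum_{i=0}^k I_{i,k-i}\frac{\omega_1^i\,\omega_2^{k-i}}{i!\,(k-i)!},\qquad k=0,1,2,\dots$$ Then the functions $I_{i,j}$ are rational differential $\mathrm{SL}_2(\mathbb{C})$-invariants of order $(i+j)$, and any rational differential $\mathrm{SL}_2(\mathbb{C})$-invariant is a rational function of them.
   Context: $\mathbf{J}^k$ is the space of $k$-jets of functions on $\mathbb{C}^2$ with canonical coordinates $x,y,u_{ij}$ ($0\le i+j\le k$), where $u_{ij}([f]^k_p)=\frac{\partial^{i+j}f}{\partial x^i\partial y^j}(p)$. The group $\mathrm{SL}_2(\mathbb{C})$ acts linearly on $\mathbb{C}^2$, on functions by $Af=f\circ A^{-1}$, and on $\mathbf{J}^k$ by $A^{(k)}([f]_p^k)=[Af]^k_{Ap}$. $\mathcal{E}_k\subset\mathbf{J}^k$ is the prolonged Euler equation of degree $n$, given by $\frac{d^{a+b}}{dx^ady^b}(xu_{10}+yu_{01}-nu_{00})=0$, $0\le a+b\le k-1$ ($\mathcal{E}_0=\mathbf{J}^0$), considered over $\mathbb{C}^2\setminus\{0\}$; $\frac{d}{dx},\frac{d}{dy}$ are total derivatives. It is preserved by all $A^{(k)}$. A rational differential $\mathrm{SL}_2$-invariant of order $k$ is a rational function $I$ on $\mathcal{E}_k$ with $I\circ A^{(k)}=I$ for all $A\in\mathrm{SL}_2(\mathbb{C})$. Functions on $\mathcal{E}_l$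 with $l<k$ are regarded as functions on $\mathcal{E}_k$ by pull-back. All functions below are restricted to the Euler equation. Symmetric tensors: $\Theta_k=\sum_{i=0}^k u_{i,k-i}\frac{dx^i}{i!}\frac{dy^{k-i}}{(k-i)!}$. Coframe: with $\Delta_2=u_{20}u_{02}-u_{11}^2$ and $J_{21}=u_{01}^2u_{20}-2u_{10}u_{01}u_{11}+u_{10}^2u_{02}$, $$\omega_1=\frac{u_{20}u_{01}-u_{11}u_{10}}{J_{21}}dx-\frac{u_{02}u_{10}-u_{11}u_{01}}{J_{21}}dy,\qquad \omega_2=\frac{\Delta_2}{2J_{21}}(u_{10}dx+u_{01}dy).$$ *)

theory Defs
  imports "HOL-Analysis.Analysis"
begin

section \<open>Jets of functions of two complex variables\<close>

definition pdx :: "(complex^2 \<Rightarrow> complex) \<Rightarrow> complex^2 \<Rightarrow> complex" where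
  "pdx f p = deriv (\<lambda>t. f (vector [t, p$2])) (p$1)"

definition pdy :: "(complex^2 \<Rightarrow> complex) \<Rightarrow> complex^2 \<Rightarrow> complex" where
  "pdy f p = deriv (\<lambda>t. f (vector [p$1, t])) (p$2)"

text \<open>
  A point \<open>(p, u)\<close> carries the base point \<open>p = (x, y)\<close> and the coordinates \<open>u i j\<close> of all orders.
  The space of \<open>k\<close>-jets consists of those points whose coordinates of order above \<open>k\<close> are zero, and
  \<open>trunc l\<close> restricts to the projection from \<open>k\<close>-jets to \<open>l\<close>-jets for \<open>l \<le> k\<close>.
\<close>

type_synonym jet = "(complex^2) \<times> (nat \<Rightarrow> nat \<Rightarrow> complex)"

abbreviation base :: "jet \<Rightarrow> complex^2" where "base \<equiv> fst"
abbreviation cx :: "jet \<Rightarrow> complex" where "cx \<theta> \<equiv> fst \<theta> $ 1"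
abbreviation cy :: "jet \<Rightarrow> complex" where "cy \<theta> \<equiv> fst \<theta> $ 2"
abbreviation cu :: "nat \<Rightarrow> nat \<Rightarrow> jet \<Rightarrow> complex" where "cu i j \<theta> \<equiv> snd \<theta> i j"

definition jet_space :: "nat \<Rightarrow> jet set" where
  "jet_space k = {\<theta>. \<forall>i j. k < i + j \<longrightarrow> cu i j \<theta> = 0}"

definition trunc :: "nat \<Rightarrow> jet \<Rightarrow> jet" where
  "trunc l \<theta> = (base \<theta>, \<lambda>i j. if i + j \<le> l then cu i j \<theta> else 0)"

definition jet_of :: "nat \<Rightarrow> (complex^2 \<Rightarrow> complex) \<Rightarrow> complex^2 \<Rightarrow> jet" where
  "jet_of k f p = (p, \<lambda>i j. if i + j \<le> k then (pdx ^^ i) ((pdy ^^ j) f) p else 0)"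


section \<open>The action of linear maps on functions and jets\<close>

definition act :: "complex^2^2 \<Rightarrow> (complex^2 \<Rightarrow> complex) \<Rightarrow> complex^2 \<Rightarrow> complex" where
  "act A f = (\<lambda>q. f (matrix_inv A *v q))"

definition taylor :: "nat \<Rightarrow> jet \<Rightarrow> complex^2 \<Rightarrow> complex" where
  "taylor k \<theta> = (\<lambda>q. \<Sum>(i, j) \<in> {(i, j). i + j \<le> k}.
     cu i j \<theta> * ((q$1 - cx \<theta>) ^ i / fact i) * ((q$2 - cy \<theta>) ^ j / fact j))"

text \<open>
  The \<open>k\<close>-jet of \<open>f\<close> at \<open>p\<close> is mapped to the \<open>k\<close>-jet of \<open>act A f\<close> at \<open>A *v p\<close>. The definition uses the
  Taylor polynomial as representative of the jet; lemmas \<open>jet_of_taylor\<close> and \<open>prolong_jet_of\<close> below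
  show that it is one, and that every representative holomorphic near \<open>p\<close> gives the same result.
\<close>

definition prolong :: "nat \<Rightarrow> complex^2^2 \<Rightarrow> jet \<Rightarrow> jet" where
  "prolong k A \<theta> = jet_of k (act A (taylor k \<theta>)) (A *v base \<theta>)"


section \<open>The prolonged Euler equation\<close>

definition dcx :: "(jet \<Rightarrow> complex) \<Rightarrow> jet \<Rightarrow> complex" where
  "dcx F \<theta> = deriv (\<lambda>t. F (vector [t, cy \<theta>], snd \<theta>)) (cx \<theta>)"

definition dcy :: "(jet \<Rightarrow> complex) \<Rightarrow> jet \<Rightarrow> complex" where
  "dcy F \<theta> = deriv (\<lambda>t. F (vector [cx \<theta>, t], snd \<theta>)) (cy \<theta>)"

definition dcu :: "nat \<Rightarrow> nat \<Rightarrow> (jet \<Rightarrow> complex) \<Rightarrow> jet \<Rightarrow> complex" where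
  "dcu i j F \<theta> = deriv (\<lambda>t. F (base \<theta>, (snd \<theta>)(i := (snd \<theta> i)(j := t)))) (cu i j \<theta>)"

text \<open>
  Total derivatives. A function of finite order depends on finitely many coordinates, so the index
  sets of the sums below are finite for it.
\<close>

definition tdx :: "(jet \<Rightarrow> complex) \<Rightarrow> jet \<Rightarrow> complex" where
  "tdx F \<theta> = dcx F \<theta> + (\<Sum>(i, j) \<in> {(i, j). dcu i j F \<theta> \<noteq> 0}. cu (Suc i) j \<theta> * dcu i j F \<theta>)"

definition tdy :: "(jet \<Rightarrow> complex) \<Rightarrow> jet \<Rightarrow> complex" where
  "tdy F \<theta> = dcy F \<theta> + (\<Sum>(i, j) \<in> {(i, j). dcu i j F \<theta> \<noteq> 0}. cu i (Suc j) \<theta> * dcu i j F \<theta>)"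

definition euler_expr :: "nat \<Rightarrow> jet \<Rightarrow> complex" where
  "euler_expr n \<theta> = cx \<theta> * cu 1 0 \<theta> + cy \<theta> * cu 0 1 \<theta> - of_nat n * cu 0 0 \<theta>"

definition euler_eq :: "nat \<Rightarrow> nat \<Rightarrow> jet set" where
  "euler_eq n k = {\<theta> \<in> jet_space k. base \<theta> \<noteq> 0 \<and>
     (\<forall>a b. a + b < k \<longrightarrow> (tdx ^^ a) ((tdy ^^ b) (euler_expr n)) \<theta> = 0)}"


lemma total_derivatives_linear:
  fixes c :: complex and a b :: nat
  defines "F \<equiv> \<lambda>c a b \<theta>. cx \<theta> * cu (Suc a) b \<theta> + cy \<theta> * cu a (Suc b) \<theta> + c * cu a b \<theta>"
  shows "tdx (F c a b) = F (c + 1) (Suc a) b" and "tdy (F c a b) = F (c + 1) a (Suc b)"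
proof -
  have dcx: "dcx (F c a b) \<theta> = cu (Suc a) b \<theta>" and dcy: "dcy (F c a b) \<theta> = cu a (Suc b) \<theta>" for \<theta>
    unfolding dcx_def dcy_def F_def by (rule DERIV_imp_deriv, (rule derivative_eq_intros refl | simp)+)+
  have dcu: "dcu i j (F c a b) \<theta> = (if (i, j) = (Suc a, b) then cx \<theta> else 0)
      + (if (i, j) = (a, Suc b) then cy \<theta> else 0) + (if (i, j) = (a, b) then c else 0)" for i j \<theta>
  proof -
    have "((\<lambda>t. ((snd \<theta>)(i := (snd \<theta> i)(j := t))) k l) has_field_derivative
        (if (i, j) = (k, l) then 1 else 0)) (at z)" for k l z
      by (cases "i = k"; cases "j = l") auto
    note d = this DERIV_cmult[OF this]
    show ?thesis
      unfolding dcu_def F_def fst_conv snd_conv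
      by (rule DERIV_imp_deriv, rule DERIV_cong, (rule DERIV_add d)+) auto
  qed
  have sum: "(\<Sum>(i, j) \<in> {(i, j). dcu i j (F c a b) \<theta> \<noteq> 0}. w i j * dcu i j (F c a b) \<theta>)
      = w (Suc a) b * cx \<theta> + w a (Suc b) * cy \<theta> + w a b * c" for \<theta> and w :: "nat \<Rightarrow> nat \<Rightarrow> complex"
  proof -
    have "(\<Sum>(i, j) \<in> {(i, j). dcu i j (F c a b) \<theta> \<noteq> 0}. w i j * dcu i j (F c a b) \<theta>)
        = (\<Sum>(i, j) \<in> {(Suc a, b), (a, Suc b), (a, b)}. w i j * dcu i j (F c a b) \<theta>)"
      by (intro sum.mono_neutral_left) (auto simp: dcu split: if_splits)
    also have "\<dots> = w (Suc a) b * cx \<theta> + w a (Suc b) * cy \<theta> + w a b * c"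
      by (simp add: dcu)
    finally show ?thesis .
  qed
  show "tdx (F c a b) = F (c + 1) (Suc a) b"
    unfolding tdx_def sum dcx by (auto simp: F_def algebra_simps)
  show "tdy (F c a b) = F (c + 1) a (Suc b)"
    unfolding tdy_def sum dcy by (auto simp: F_def algebra_simps)
qed

lemma total_derivatives_euler_expr:
  "(tdx ^^ a) ((tdy ^^ b) (euler_expr n)) \<theta> =
     cx \<theta> * cu (Suc a) b \<theta> + cy \<theta> * cu a (Suc b) \<theta> + (of_nat (a + b) - of_nat n) * cu a b \<theta>"
proof -
  define F where "F = (\<lambda>c a b \<theta>. cx \<theta> * cu (Suc a) b \<theta> + cy \<theta> * cu a (Suc b) \<theta> + c * cu a b \<theta>)"
  have td: "tdx (F c a b) = F (c + 1) (Suc a) b" "tdy (F c a b) = F (c + 1) a (Suc b)" for c a b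
    unfolding F_def by (rule total_derivatives_linear)+
  have "euler_expr n = F (- of_nat n) 0 0"
    by (auto simp: F_def euler_expr_def)
  then have "(tdy ^^ b) (euler_expr n) = F (of_nat b - of_nat n) 0 b"
    by (induction b) (simp_all add: td algebra_simps)
  then have "(tdx ^^ a) ((tdy ^^ b) (euler_expr n)) = F (of_nat (a + b) - of_nat n) a b"
    by (induction a) (simp_all add: td algebra_simps)
  then show ?thesis by (simp add: F_def)
qed


section \<open>Rational functions and rational differential invariants\<close>

inductive_set generated_algebra :: "('a \<Rightarrow> complex) set \<Rightarrow> ('a \<Rightarrow> complex) set"
  for G :: "('a \<Rightarrow> complex) set" where
  const: "(\<lambda>_. c) \<in> generated_algebra G"
| gen: "g \<in> G \<Longrightarrow> g \<in> generated_algebra G"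
| add: "f \<in> generated_algebra G \<Longrightarrow> g \<in> generated_algebra G \<Longrightarrow>
    (\<lambda>\<theta>. f \<theta> + g \<theta>) \<in> generated_algebra G"
| mult: "f \<in> generated_algebra G \<Longrightarrow> g \<in> generated_algebra G \<Longrightarrow>
    (\<lambda>\<theta>. f \<theta> * g \<theta>) \<in> generated_algebra G"

definition jet_polys :: "nat \<Rightarrow> (jet \<Rightarrow> complex) set" where
  "jet_polys k = generated_algebra ({cx, cy} \<union> {cu i j | i j. i + j \<le> k})"

text \<open>
  The variety \<open>euler_eq n k\<close> is irreducible (it is a vector bundle over the punctured plane), so a
  rational function on it is a function on a nonempty principal open subset that is a quotient of
  polynomials there, and two of them are equal iff they agree on such a subset. Rational functions
  are represented by total functions; \<open>rat_eq n k\<close> is their equality, which disregards the values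
  on a proper closed subset (and in particular the values at zeros of denominators).
\<close>

definition rat_eq :: "nat \<Rightarrow> nat \<Rightarrow> (jet \<Rightarrow> complex) \<Rightarrow> (jet \<Rightarrow> complex) \<Rightarrow> bool" where
  "rat_eq n k f g \<longleftrightarrow> (\<exists>D \<in> jet_polys k. (\<exists>\<theta> \<in> euler_eq n k. D \<theta> \<noteq> 0) \<and>
     (\<forall>\<theta> \<in> euler_eq n k. D \<theta> \<noteq> 0 \<longrightarrow> f \<theta> = g \<theta>))"

definition rational_on :: "nat \<Rightarrow> nat \<Rightarrow> (jet \<Rightarrow> complex) \<Rightarrow> bool" where
  "rational_on n k f \<longleftrightarrow> (\<exists>P \<in> jet_polys k. \<exists>Q \<in> jet_polys k.
     (\<exists>\<theta> \<in> euler_eq n k. Q \<theta> \<noteq> 0) \<and> rat_eq n k f (\<lambda>\<theta>. P \<theta> / Q \<theta>))"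

definition rational_invariant :: "nat \<Rightarrow> nat \<Rightarrow> (jet \<Rightarrow> complex) \<Rightarrow> bool" where
  "rational_invariant n k f \<longleftrightarrow> rational_on n k f \<and>
     (\<forall>A. det A = 1 \<longrightarrow> rat_eq n k (f \<circ> prolong k A) f)"


section \<open>Symmetric tensors and the invariant coframe\<close>

text \<open>
  A symmetric \<open>k\<close>-tensor at a point is identified with the homogeneous polynomial of degree \<open>k\<close> that
  it induces on tangent vectors \<open>v\<close>; symmetric products are pointwise products, and \<open>dx\<close>, \<open>dy\<close> are
  the coordinates \<open>v$1\<close>, \<open>v$2\<close>.
\<close>

definition Theta :: "nat \<Rightarrow> jet \<Rightarrow> complex^2 \<Rightarrow> complex" where
  "Theta k \<theta> v = (\<Sum>i\<le>k. cu i (k - i) \<theta> * ((v$1) ^ i / fact i) * ((v$2) ^ (k - i) / fact (k - i)))"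

definition Delta2 :: "jet \<Rightarrow> complex" where
  "Delta2 \<theta> = cu 2 0 \<theta> * cu 0 2 \<theta> - (cu 1 1 \<theta>)\<^sup>2"

definition J21 :: "jet \<Rightarrow> complex" where
  "J21 \<theta> = (cu 0 1 \<theta>)\<^sup>2 * cu 2 0 \<theta> - 2 * cu 1 0 \<theta> * cu 0 1 \<theta> * cu 1 1 \<theta> + (cu 1 0 \<theta>)\<^sup>2 * cu 0 2 \<theta>"

definition omega1 :: "jet \<Rightarrow> complex^2 \<Rightarrow> complex" where
  "omega1 \<theta> v = (cu 2 0 \<theta> * cu 0 1 \<theta> - cu 1 1 \<theta> * cu 1 0 \<theta>) / J21 \<theta> * v$1
     - (cu 0 2 \<theta> * cu 1 0 \<theta> - cu 1 1 \<theta> * cu 0 1 \<theta>) / J21 \<theta> * v$2"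

definition omega2 :: "jet \<Rightarrow> complex^2 \<Rightarrow> complex" where
  "omega2 \<theta> v = Delta2 \<theta> / (2 * J21 \<theta>) * (cu 1 0 \<theta> * v$1 + cu 0 1 \<theta> * v$2)"

text \<open>
  \<open>c i\<close> is the coefficient at \<open>omega1\<^sup>i omega2\<^sup>k\<^sup>-\<^sup>i / (i! (k-i)!)\<close>. By lemma \<open>ex1_coframe_coeffs\<close> below
  the coefficients exist and are unique wherever \<open>omega1\<close>, \<open>omega2\<close> are defined and form a coframe.
\<close>

definition coframe_coeffs :: "nat \<Rightarrow> jet \<Rightarrow> (nat \<Rightarrow> complex) \<Rightarrow> bool" where
  "coframe_coeffs k \<theta> c \<longleftrightarrow> (\<forall>i>k. c i = 0) \<and>
     (\<forall>v. Theta k \<theta> v =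
       (\<Sum>i\<le>k. c i * (omega1 \<theta> v ^ i * omega2 \<theta> v ^ (k - i)) / (fact i * fact (k - i))))"

definition inv_coeff :: "nat \<Rightarrow> nat \<Rightarrow> jet \<Rightarrow> complex" where
  "inv_coeff i j \<theta> = (THE c. coframe_coeffs (i + j) \<theta> c) i"


section \<open>The prolonged action is well defined\<close>

text \<open>
  A function is holomorphic on an open set \<open>U\<close> iff it is the member \<open>g 0 0\<close> of a family \<open>g\<close> as follows.
\<close>

definition partials_on :: "(complex^2) set \<Rightarrow> (nat \<Rightarrow> nat \<Rightarrow> complex^2 \<Rightarrow> complex) \<Rightarrow> bool" where
  "partials_on U g \<longleftrightarrow> (\<forall>i j. \<forall>q\<in>U.
     (g i j has_derivative (\<lambda>v. g (Suc i) j q * v$1 + g i (Suc j) q * v$2)) (at q))"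

lemma has_derivative_vec_cart:
  fixes f :: "complex^2 \<Rightarrow> complex"
  assumes "(f has_derivative (\<lambda>v. a * v$1 + b * v$2)) (at q)"
  shows "((\<lambda>t. f (vector [t, q$2])) has_field_derivative a) (at (q$1))"
    and "((\<lambda>t. f (vector [q$1, t])) has_field_derivative b) (at (q$2))"
proof -
  have eq1: "(\<lambda>t. vector [t, q$2] :: complex^2) = (\<lambda>t. axis 1 t + axis 2 (q$2))"
    by (auto simp: vec_eq_iff axis_def forall_2)
  have eq2: "(\<lambda>t. vector [q$1, t] :: complex^2) = (\<lambda>t. axis 1 (q$1) + axis 2 t)"
    by (auto simp: vec_eq_iff axis_def forall_2)
  have bl: "bounded_linear (\<lambda>t::complex. axis i t :: complex^2)" for i
    by (intro linear_conv_bounded_linear[THEN iffD1] linearI)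
       (auto simp: vec_eq_iff axis_def)
  have d1: "((\<lambda>t. vector [t, q$2] :: complex^2) has_derivative (\<lambda>t. axis 1 t)) (at (q$1))"
    unfolding eq1 by (rule has_derivative_eq_rhs, (rule derivative_intros bounded_linear.has_derivative[OF bl])+) auto
  have d2: "((\<lambda>t. vector [q$1, t] :: complex^2) has_derivative (\<lambda>t. axis 2 t)) (at (q$2))"
    unfolding eq2 by (rule has_derivative_eq_rhs, (rule derivative_intros bounded_linear.has_derivative[OF bl])+) auto
  have v: "vector [q$1, q$2] = q"
    by (auto simp: vec_eq_iff forall_2)
  show "((\<lambda>t. f (vector [t, q$2])) has_field_derivative a) (at (q$1))"
    using has_derivative_compose[OF d1, of f "\<lambda>v. a * v$1 + b * v$2"] assms v
    by (simp add: has_field_derivative_def axis_def)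
  show "((\<lambda>t. f (vector [q$1, t])) has_field_derivative b) (at (q$2))"
    using has_derivative_compose[OF d2, of f "\<lambda>v. a * v$1 + b * v$2"] assms v
    by (simp add: has_field_derivative_def axis_def)
qed

lemma iterated_partials:
  assumes "open U" "partials_on U g" "q \<in> U"
  shows "(pdx ^^ i) ((pdy ^^ j) (g 0 0)) q = g i j q"
proof -
  have der: "pdx f q = a \<and> pdy f q = b"
    if q: "q \<in> U" and fg: "\<And>r. r \<in> U \<Longrightarrow> f r = h r"
      and h: "(h has_derivative (\<lambda>v. a * v$1 + b * v$2)) (at q)" for f h a b q
  proof -
    have "(f has_derivative (\<lambda>v. a * v$1 + b * v$2)) (at q)"
      using has_derivative_transform_within_open[OF h \<open>open U\<close> q] fg by simp
    from has_derivative_vec_cart[OF this] show ?thesis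
      by (simp add: pdx_def pdy_def DERIV_imp_deriv)
  qed
  have y: "(pdy ^^ j) (g 0 0) q = g 0 j q" if "q \<in> U" for q j
    using that
  proof (induction j arbitrary: q)
    case (Suc j)
    then show ?case
      using der[of q "(pdy ^^ j) (g 0 0)" "g 0 j" "g (Suc 0) j q" "g 0 (Suc j) q"] assms(2) unfolding partials_on_def by simp
  qed simp
  show ?thesis using \<open>q \<in> U\<close>
  proof (induction i arbitrary: q)
    case (Suc i)
    then show ?case
      using der[of q "(pdx ^^ i) ((pdy ^^ j) (g 0 0))" "g i j" "g (Suc i) j q" "g i (Suc j) q"] assms(2)
      unfolding partials_on_def by simp
  qed (simp add: y)
qed

lemma partials_on_taylor:
  obtains g where "partials_on UNIV g" "g 0 0 = taylor k \<theta>"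
    "\<And>i j. i + j \<le> k \<Longrightarrow> g i j (base \<theta>) = cu i j \<theta>"
proof -
  define D where "D a i t = (if a \<le> i then t ^ (i - a) / fact (i - a) else 0)"
    for a i and t :: complex
  define g where "g a b q = (\<Sum>(i, j) \<in> {(i, j). i + j \<le> k}.
      cu i j \<theta> * D a i (q$1 - cx \<theta>) * D b j (q$2 - cy \<theta>))" for a b and q :: "complex^2"
  have D: "(D a i has_field_derivative D (Suc a) i t) (at t)" for a i t
  proof -
    consider "a < i" | "a = i" | "a > i" by linarith
    then show ?thesis
    proof cases
      case 1
      then obtain m where m: "i - a = Suc m" "i - Suc a = m" by (cases "i - a") auto
      have "((\<lambda>t. t ^ Suc m / fact (Suc m)) has_field_derivative
          (of_nat (Suc m) * t ^ m / fact (Suc m))) (at t)"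
        by (intro DERIV_cdivide) (rule derivative_eq_intros refl | simp)+
      moreover have "of_nat (Suc m) * t ^ m / fact (Suc m) = t ^ m / fact m"
        by (simp del: of_nat_Suc)
      ultimately have "((\<lambda>t. t ^ Suc m / fact (Suc m)) has_field_derivative (t ^ m / fact m)) (at t)"
        by simp
      with 1 m show ?thesis unfolding D_def by simp
    qed (auto simp: D_def[abs_def])
  qed
  have fin: "finite {(i, j). i + j \<le> k}"
    by (rule finite_subset[of _ "{..k} \<times> {..k}"]) auto
  have "partials_on UNIV g"
    unfolding partials_on_def
  proof (intro allI ballI)
    fix a b and q :: "complex^2"
    have dD: "((\<lambda>q::complex^2. D a i (q$l - c)) has_derivative
        (\<lambda>v. D (Suc a) i (q$l - c) * v$l)) (at q)" for a i l c
    proof -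
      have "((\<lambda>q::complex^2. q$l - c) has_derivative (\<lambda>v. v$l)) (at q)"
        by (rule has_derivative_eq_rhs, (rule derivative_intros bounded_linear.has_derivative bounded_linear_vec_nth)+) auto
      from has_derivative_compose[OF this D[unfolded has_field_derivative_def]]
      show ?thesis by simp
    qed
    show "(g a b has_derivative (\<lambda>v. g (Suc a) b q * v$1 + g a (Suc b) q * v$2)) (at q)"
      unfolding g_def[abs_def] case_prod_unfold
      by (rule has_derivative_eq_rhs,
          (rule has_derivative_sum has_derivative_mult has_derivative_const dD)+)
         (simp add: fun_eq_iff sum.distrib sum_distrib_left algebra_simps)
  qed
  moreover have "g 0 0 = taylor k \<theta>"
    by (simp add: g_def taylor_def D_def fun_eq_iff)
  moreover have "g a b (base \<theta>) = cu a b \<theta>" if "a + b \<le> k" for a b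
  proof -
    have D0: "D a i 0 = (if i = a then 1 else 0)" for a i by (auto simp: D_def)
    have "g a b (base \<theta>) = (\<Sum>p \<in> {(i, j). i + j \<le> k}. if p = (a, b) then cu a b \<theta> else 0)"
      unfolding g_def by (intro sum.cong) (auto simp: D0 split: if_splits)
    also have "\<dots> = cu a b \<theta>" using that by (simp add: sum.delta[OF fin])
    finally show ?thesis .
  qed
  ultimately show ?thesis using that by blast
qed

lemma jet_of_taylor:
  assumes "\<theta> \<in> jet_space k"
  shows "jet_of k (taylor k \<theta>) (base \<theta>) = \<theta>"
proof -
  obtain g where g: "partials_on UNIV g" "g 0 0 = taylor k \<theta>"
    "\<And>i j. i + j \<le> k \<Longrightarrow> g i j (base \<theta>) = cu i j \<theta>"
    using partials_on_taylor by blast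
  show ?thesis
    using iterated_partials[OF open_UNIV g(1) UNIV_I, of _ _ "base \<theta>"] g assms
    by (auto simp: jet_of_def jet_space_def prod_eq_iff fun_eq_iff)
qed

lemma bounded_linear_matrix_mult: "bounded_linear (\<lambda>q. (B :: complex^2^2) *v q)"
  by (intro linear_conv_bounded_linear[THEN iffD1] linearI)
     (auto simp: matrix_vector_mult_def vec_eq_iff sum_2 algebra_simps)

lemma partials_on_linear:
  fixes B :: "complex^2^2"
  assumes "partials_on U g"
  defines "X \<equiv> \<lambda>h a b. B$1$1 * h (Suc a) b + B$2$1 * h a (Suc b)"
    and "Y \<equiv> \<lambda>h a b. B$1$2 * h (Suc a) b + B$2$2 * h a (Suc b)"
  shows "partials_on ((\<lambda>q. B *v q) -` U)
    (\<lambda>i j q. ((X ^^ i) ((Y ^^ j) (\<lambda>a b. g a b (B *v q)))) 0 0)"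
proof -
  define T where "T M h = (\<lambda>a b q. fst M * h (Suc a) b q + snd M * h a (Suc b) q)"
    for M :: "complex \<times> complex" and h :: "nat \<Rightarrow> nat \<Rightarrow> complex^2 \<Rightarrow> complex"
  have X: "(X ^^ i) (\<lambda>a b. h a b q) a b = (T (B$1$1, B$2$1) ^^ i) h a b q" for i h q a b
    by (induction i arbitrary: a b) (auto simp: X_def T_def)
  have Y: "(Y ^^ i) (\<lambda>a b. h a b q) a b = (T (B$1$2, B$2$2) ^^ i) h a b q" for i h q a b
    by (induction i arbitrary: a b) (auto simp: Y_def T_def)
  have XY: "(X ^^ i) ((Y ^^ j) (\<lambda>a b. h a b q)) a b
      = (T (B$1$1, B$2$1) ^^ i) ((T (B$1$2, B$2$2) ^^ j) h) a b q" for i j h q a b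
  proof -
    have "(Y ^^ j) (\<lambda>a b. h a b q) = (\<lambda>a b. (T (B$1$2, B$2$2) ^^ j) h a b q)"
      by (intro ext) (rule Y)
    then show ?thesis by (simp only: X)
  qed
  have comm: "T M (T N h) = T N (T M h)" for M N h
    by (auto simp: T_def fun_eq_iff algebra_simps)
  have comm2: "T M ((T N ^^ i) h) = (T N ^^ i) (T M h)" for M N i h
    by (induction i) (simp_all add: comm[of M N])
  have pT: "partials_on U (T M h)" if "partials_on U h" for M h
    unfolding partials_on_def
  proof (intro allI ballI)
    fix a b q assume q: "q \<in> U"
    note d = that[unfolded partials_on_def, rule_format, OF q]
    show "(T M h a b has_derivative (\<lambda>v. T M h (Suc a) b q * v$1 + T M h a (Suc b) q * v$2)) (at q)"
      unfolding T_def
      by (rule has_derivative_eq_rhs, (rule d has_derivative_add has_derivative_mult_right)+)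
         (simp add: fun_eq_iff algebra_simps)
  qed
  have pTi: "partials_on U ((T M ^^ i) h)" if "partials_on U h" for M i h
    by (induction i) (simp_all add: that pT)
  show ?thesis
    unfolding partials_on_def XY
  proof (intro allI ballI)
    fix i j and q assume "q \<in> (\<lambda>q. B *v q) -` U"
    then have q: "B *v q \<in> U" by simp
    define H where "H = (T (B$1$1, B$2$1) ^^ i) ((T (B$1$2, B$2$2) ^^ j) g)"
    have "partials_on U H" unfolding H_def by (intro pTi assms)
    then have d: "(H 0 0 has_derivative
        (\<lambda>v. H (Suc 0) 0 (B *v q) * v$1 + H 0 (Suc 0) (B *v q) * v$2)) (at (B *v q))"
      using q unfolding partials_on_def by blast
    have l: "((\<lambda>q. B *v q) has_derivative (\<lambda>q. B *v q)) (at q)"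
      by (intro bounded_linear.has_derivative[OF bounded_linear_matrix_mult has_derivative_ident])
    have H1: "(T (B$1$1, B$2$1) ^^ Suc i) ((T (B$1$2, B$2$2) ^^ j) g) = T (B$1$1, B$2$1) H"
      by (simp add: H_def)
    have H2: "(T (B$1$1, B$2$1) ^^ i) ((T (B$1$2, B$2$2) ^^ Suc j) g) = T (B$1$2, B$2$2) H"
      by (simp add: H_def comm2)
    show "((\<lambda>q. (T (B$1$1, B$2$1) ^^ i) ((T (B$1$2, B$2$2) ^^ j) g) 0 0 (B *v q)) has_derivative
        (\<lambda>v. (T (B$1$1, B$2$1) ^^ Suc i) ((T (B$1$2, B$2$2) ^^ j) g) 0 0 (B *v q) * v$1 +
             (T (B$1$1, B$2$1) ^^ i) ((T (B$1$2, B$2$2) ^^ Suc j) g) 0 0 (B *v q) * v$2)) (at q)"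
      unfolding H1 H2 H_def[symmetric]
      by (rule has_derivative_eq_rhs[OF has_derivative_compose[OF l d]])
         (simp add: T_def fun_eq_iff matrix_vector_mult_def sum_2 algebra_simps)
  qed
qed

lemma prolong_jet_of:
  assumes A: "invertible A" and U: "open U" "p \<in> U" "partials_on U g"
  shows "prolong k A (jet_of k (g 0 0) p) = jet_of k (act A (g 0 0)) (A *v p)"
proof -
  define B where "B = matrix_inv A"
  define \<theta> where "\<theta> = jet_of k (g 0 0) p"
  have BA: "B *v (A *v p) = p"
  proof -
    have "B ** A = mat 1"
      using A unfolding B_def matrix_inv_def invertible_def by (rule someI2_ex) simp
    then show ?thesis by (simp add: matrix_vector_mul_assoc)
  qed
  define X where "X = (\<lambda>h a b. B$1$1 * h (Suc a) b + B$2$1 * h a (Suc b))"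
  define Y where "Y = (\<lambda>h a b. B$1$2 * h (Suc a) b + B$2$2 * h a (Suc b))"
  obtain h where h: "partials_on UNIV h" "h 0 0 = taylor k \<theta>"
    "\<And>i j. i + j \<le> k \<Longrightarrow> h i j (base \<theta>) = cu i j \<theta>"
    using partials_on_taylor by blast
  have base: "base \<theta> = p" by (simp add: \<theta>_def jet_of_def)
  have gh: "g i j p = h i j p" if "i + j \<le> k" for i j
    using h(3)[OF that] iterated_partials[OF U(1,3,2)] that by (simp add: \<theta>_def jet_of_def)
  have "continuous_on UNIV (\<lambda>q. B *v q)"
    by (rule linear_continuous_on[OF bounded_linear_matrix_mult])
  then have V: "open ((\<lambda>q. B *v q) -` W)" if "open W" for W
    using that by (simp add: continuous_on_open_vimage)
  have *: "(pdx ^^ i) ((pdy ^^ j) (act A (g 0 0))) (A *v p) = (X ^^ i) ((Y ^^ j) (\<lambda>a b. g a b p)) 0 0"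
    if "open U" "p \<in> U" "partials_on U g" for U g i j
    using iterated_partials[OF V[OF that(1)] partials_on_linear[OF that(3), of B], of "A *v p" i j]
      that(2) BA by (simp add: act_def X_def Y_def B_def)
  have Yloc: "(Y ^^ j) u a b = (Y ^^ j) w a b"
    if "\<And>a b. a + b \<le> k \<Longrightarrow> u a b = w a b" "j + a + b \<le> k" for u w :: "nat \<Rightarrow> nat \<Rightarrow> complex" and j a b
    using that(2) by (induction j arbitrary: a b) (auto simp: Y_def that(1))
  have Xloc: "(X ^^ i) ((Y ^^ j) u) a b = (X ^^ i) ((Y ^^ j) w) a b"
    if "\<And>a b. a + b \<le> k \<Longrightarrow> u a b = w a b" "i + j + a + b \<le> k" for u w :: "nat \<Rightarrow> nat \<Rightarrow> complex" and i j a b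
    using that(2) by (induction i arbitrary: a b) (auto simp: X_def intro: Yloc[OF that(1)])
  show ?thesis
    unfolding prolong_def \<theta>_def[symmetric] h(2)[symmetric] base
    by (auto simp: jet_of_def fun_eq_iff *[OF U] *[OF open_UNIV UNIV_I h(1)] gh intro!: Xloc)
qed


section \<open>Existence and uniqueness of the coefficients\<close>

lemma ex1_coframe_coeffs:
  assumes J: "J21 \<theta> \<noteq> 0" and D: "Delta2 \<theta> \<noteq> 0"
  shows "\<exists>!c. coframe_coeffs k \<theta> c"
proof -
  let ?a = "omega1 \<theta>" and ?b = "omega2 \<theta>"
  define H where "H k f \<longleftrightarrow> (\<exists>c. \<forall>v. f v = (\<Sum>i\<le>k. c i * (?a v ^ i * ?b v ^ (k - i))))"
    for k and f :: "complex^2 \<Rightarrow> complex"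
  define p where "p = (cu 2 0 \<theta> * cu 0 1 \<theta> - cu 1 1 \<theta> * cu 1 0 \<theta>) / J21 \<theta>"
  define q where "q = (cu 0 2 \<theta> * cu 1 0 \<theta> - cu 1 1 \<theta> * cu 0 1 \<theta>) / J21 \<theta>"
  define e where "e = Delta2 \<theta> / (2 * J21 \<theta>)"
  have a: "?a v = p * v$1 - q * v$2" and b: "?b v = e * (cu 1 0 \<theta> * v$1 + cu 0 1 \<theta> * v$2)" for v
    by (simp_all add: omega1_def omega2_def p_def q_def e_def)
  have e0: "e \<noteq> 0" using J D by (simp add: e_def)
  have det: "p * cu 0 1 \<theta> + q * cu 1 0 \<theta> = 1"
    using J by (simp add: p_def q_def field_simps) (simp add: J21_def power2_eq_square algebra_simps)
  have Hadd: "H k (\<lambda>v. f v + g v)" if "H k f" "H k g" for k f g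
    using that unfolding H_def
    by (elim exE, rule_tac x = "\<lambda>i. c i + ca i" in exI) (simp add: algebra_simps sum.distrib)
  have Hscale: "H k (\<lambda>v. s * f v)" if "H k f" for k s f
    using that unfolding H_def
    by (elim exE, rule_tac x = "\<lambda>i. s * c i" in exI) (simp add: algebra_simps sum_distrib_left)
  have Ha: "H (Suc k) (\<lambda>v. ?a v * f v)" if "H k f" for k f
  proof -
    from that obtain c where "\<And>v. f v = (\<Sum>i\<le>k. c i * (?a v ^ i * ?b v ^ (k - i)))"
      unfolding H_def by blast
    then show ?thesis unfolding H_def
      by (intro exI[of _ "\<lambda>i. case i of 0 \<Rightarrow> 0 | Suc i \<Rightarrow> c i"] allI, subst sum.atMost_Suc_shift)
         (simp add: sum_distrib_left algebra_simps)
  qed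
  have Hb: "H (Suc k) (\<lambda>v. ?b v * f v)" if "H k f" for k f
  proof -
    from that obtain c where c: "\<And>v. f v = (\<Sum>i\<le>k. c i * (?a v ^ i * ?b v ^ (k - i)))"
      unfolding H_def by blast
    have "?b v * f v = (\<Sum>i\<le>Suc k. (if i \<le> k then c i else 0) * (?a v ^ i * ?b v ^ (Suc k - i)))" for v
      unfolding c sum_distrib_left sum.atMost_Suc
      by (simp, intro sum.cong) (auto simp: Suc_diff_le algebra_simps)
    then show ?thesis
      unfolding H_def by (intro exI[of _ "\<lambda>i. if i \<le> k then c i else 0"] allI)
  qed
  have H1: "H (Suc k) (\<lambda>v. v$1 * f v)" if "H k f" for k f
  proof -
    have v: "v$1 = cu 0 1 \<theta> * ?a v + (q / e) * ?b v" for v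
    proof -
      have "cu 0 1 \<theta> * ?a v + (q / e) * ?b v = (p * cu 0 1 \<theta> + q * cu 1 0 \<theta>) * v$1"
        using e0 unfolding a b by (simp add: algebra_simps)
      then show ?thesis unfolding det by simp
    qed
    have "(\<lambda>v. v$1 * f v) = (\<lambda>v. cu 0 1 \<theta> * (?a v * f v) + (q / e) * (?b v * f v))"
      by (intro ext, subst v) (simp add: algebra_simps)
    then show ?thesis by (simp only:) (intro Hadd Hscale Ha Hb that)
  qed
  have H2: "H (Suc k) (\<lambda>v. v$2 * f v)" if "H k f" for k f
  proof -
    have v: "v$2 = - cu 1 0 \<theta> * ?a v + (p / e) * ?b v" for v
    proof -
      have "- cu 1 0 \<theta> * ?a v + (p / e) * ?b v = (p * cu 0 1 \<theta> + q * cu 1 0 \<theta>) * v$2"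
        using e0 unfolding a b by (simp add: algebra_simps)
      then show ?thesis unfolding det by simp
    qed
    have "(\<lambda>v. v$2 * f v) = (\<lambda>v. - cu 1 0 \<theta> * (?a v * f v) + (p / e) * (?b v * f v))"
      by (intro ext, subst v) (simp add: algebra_simps)
    then show ?thesis by (simp only:) (intro Hadd Hscale Ha Hb that)
  qed
  have Hmon: "H (i + j) (\<lambda>v. v$1 ^ i * v$2 ^ j)" for i j
  proof (induction i)
    case 0
    show ?case
    proof (induction j)
      case 0
      show ?case unfolding H_def by (rule exI[of _ "\<lambda>_. 1"]) simp
    next
      case (Suc j)
      then show ?case using H2 by fastforce
    qed
  next
    case (Suc i)
    from H1[OF this] show ?case by (simp add: mult.assoc)
  qed
  have Hzero: "H k (\<lambda>_. 0)" for k
    unfolding H_def by (rule exI[of _ "\<lambda>_. 0"]) simp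
  have Hsum: "H k (\<lambda>v. \<Sum>i\<in>S. f i v)" if "finite S" "\<And>i. i \<in> S \<Longrightarrow> H k (f i)" for k and S :: "nat set" and f
    using that by (induction S) (auto intro: Hadd Hzero)
  have "H k (\<lambda>v. v$1 ^ i * v$2 ^ (k - i))" if "i \<le> k" for i
    using Hmon[of i "k - i"] that by simp
  then have "H k (\<lambda>v. \<Sum>i\<le>k. (cu i (k - i) \<theta> / (fact i * fact (k - i))) * (v$1 ^ i * v$2 ^ (k - i)))"
    by (intro Hsum Hscale) auto
  then have "H k (Theta k \<theta>)"
    by (simp add: Theta_def[abs_def] mult.assoc)
  then obtain c where c: "\<And>v. Theta k \<theta> v = (\<Sum>i\<le>k. c i * (?a v ^ i * ?b v ^ (k - i)))"
    unfolding H_def by blast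
  show ?thesis
  proof (rule ex1I)
    show "coframe_coeffs k \<theta> (\<lambda>i. if i \<le> k then c i * (fact i * fact (k - i)) else 0)"
      by (simp add: coframe_coeffs_def c)
  next
    fix c' assume c': "coframe_coeffs k \<theta> c'"
    have "c i = c' i / (fact i * fact (k - i))" if "i \<le> k" for i
    proof -
      have "(\<Sum>i\<le>k. (c i - c' i / (fact i * fact (k - i))) * s ^ i) = 0" for s
      proof -
        define v :: "complex^2" where
          "v = vector [cu 0 1 \<theta> * s + q / e, - cu 1 0 \<theta> * s + p / e]"
        have "?a v = (p * cu 0 1 \<theta> + q * cu 1 0 \<theta>) * s"
          unfolding a by (simp add: v_def algebra_simps)
        then have av: "?a v = s" unfolding det by simp
        have "?b v = p * cu 0 1 \<theta> + q * cu 1 0 \<theta>"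
          using e0 unfolding b by (simp add: v_def algebra_simps)
        then have bv: "?b v = 1" unfolding det by simp
        have "(\<Sum>i\<le>k. c i * s ^ i) = (\<Sum>i\<le>k. c' i * s ^ i / (fact i * fact (k - i)))"
          using c[of v] c' unfolding coframe_coeffs_def by (simp add: av bv)
        then show ?thesis by (simp add: algebra_simps sum_subtractf)
      qed
      then have "c i - c' i / (fact i * fact (k - i)) = 0"
        using zero_polynom_imp_zero_coeffs[of "\<lambda>i. c i - c' i / (fact i * fact (k - i))" k i] that by blast
      then show ?thesis by simp
    qed
    then show "c' = (\<lambda>i. if i \<le> k then c i * (fact i * fact (k - i)) else 0)"
      using c' by (auto simp: coframe_coeffs_def fun_eq_iff)
  qed
qed

end

theory Submission
  imports Defs "HOL-Computational_Algebra.Polynomial"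
begin

text \<open>
  On the Euler equation the coframe is \<open>(y dx - x dy) / (n u)\<close>, \<open>(n - 1) du / (2 n u)\<close>, so its dual
  frame consists of constant multiples of the vectors \<open>w = (u\<^sub>0\<^sub>1, -u\<^sub>1\<^sub>0)\<close> and \<open>p = (x, y)\<close>. Contraction
  of \<open>\<Theta>\<^sub>k\<close> with \<open>p\<close> is a multiple of \<open>\<Theta>\<^sub>k\<^sub>-\<^sub>1\<close> by the Euler equation, hence \<open>I\<^sub>i\<^sub>j\<close> is a constant multiple of
  the polynomial \<open>T\<^sub>i = i! \<Theta>\<^sub>i(w)\<close>, which is invariant because \<open>w\<close> is equivariant.

  Conversely, where \<open>u \<noteq> 0\<close>, some element of \<open>SL\<^sub>2\<close> moves \<open>p\<close> to \<open>(1, 0)\<close> and \<open>w\<close> to \<open>(0, -n u)\<close>. The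
  coordinates of the resulting jet are determined by its \<open>u\<^sub>0\<^sub>b = T\<^sub>b / (-n T\<^sub>0)\<^sup>b\<close>. An invariant \<open>P/Q\<close> would
  therefore be found by evaluating \<open>P\<close> and \<open>Q\<close> at the normal form; as \<open>Q\<close> may vanish on all normal
  forms, they are first translated by a fixed element of \<open>SL\<^sub>2\<close>.
\<close>

section \<open>Linear substitutions in jets\<close>

definition ddir :: "complex^2 \<Rightarrow> (nat \<Rightarrow> nat \<Rightarrow> complex) \<Rightarrow> nat \<Rightarrow> nat \<Rightarrow> complex" where
  "ddir v u = (\<lambda>a b. v$1 * u (Suc a) b + v$2 * u a (Suc b))"

text \<open>
  If \<open>u\<close> are the partial derivatives of \<open>f\<close> at \<open>B *v p\<close>, then \<open>ddir v u\<close> are those of the derivative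
  of \<open>f\<close> along \<open>v\<close>, and \<open>pull B u\<close> are those of \<open>\<lambda>q. f (B *v q)\<close> at \<open>p\<close>.
\<close>

definition pull :: "complex^2^2 \<Rightarrow> (nat \<Rightarrow> nat \<Rightarrow> complex) \<Rightarrow> nat \<Rightarrow> nat \<Rightarrow> complex" where
  "pull B u = (\<lambda>i j. (ddir (column 1 B) ^^ i) ((ddir (column 2 B) ^^ j) u) 0 0)"

lemma ddir_commute: "ddir v (ddir w u) = ddir w (ddir v u)"
  by (simp add: ddir_def fun_eq_iff algebra_simps)

lemma ddir_pow_commute: "(ddir v ^^ i) (ddir w u) = ddir w ((ddir v ^^ i) u)"
  by (induction i) (simp_all add: ddir_commute[of v w])

lemma ddir_pow_pow_commute: "(ddir v ^^ i) ((ddir w ^^ j) u) = (ddir w ^^ j) ((ddir v ^^ i) u)"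
  by (induction j) (simp_all add: ddir_pow_commute)

lemma ddir_pow_lincomb:
  "(ddir v ^^ i) (\<lambda>a b. s * f a b + t * g a b) =
     (\<lambda>a b. s * (ddir v ^^ i) f a b + t * (ddir v ^^ i) g a b)"
  by (induction i) (simp_all add: ddir_def fun_eq_iff algebra_simps)

lemma ddir_lincomb_vector:
  "ddir (s *s v + t *s w) u = (\<lambda>a b. s * ddir v u a b + t * ddir w u a b)"
  by (simp add: ddir_def fun_eq_iff algebra_simps)

lemma ddir_pow_scale: "(ddir (s *s v) ^^ i) u a b = s ^ i * (ddir v ^^ i) u a b"
proof -
  have "ddir (s *s v) f = (\<lambda>a b. s * ddir v f a b + 0 * f a b)" for f
    by (simp add: ddir_def fun_eq_iff algebra_simps)
  then have "(ddir (s *s v) ^^ i) u = (\<lambda>a b. s ^ i * (ddir v ^^ i) u a b)"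
    by (induction i) (simp_all add: ddir_def fun_eq_iff algebra_simps)
  then show ?thesis by simp
qed

lemma ddir_pow_cong_scale:
  assumes "\<And>a b. a + b = N \<Longrightarrow> f a b = c * g a b" "i + a + b = N"
  shows "(ddir v ^^ i) f a b = c * (ddir v ^^ i) g a b"
  using assms(2)
  by (induction i arbitrary: a b) (simp_all add: assms(1) ddir_def algebra_simps)

lemma pull_cong_scale:
  assumes "\<And>a b. a + b = i + j \<Longrightarrow> f a b = c * g a b"
  shows "pull B f i j = c * pull B g i j"
  unfolding pull_def
proof (rule ddir_pow_cong_scale[of i])
  show "(ddir (column 2 B) ^^ j) f a b = c * (ddir (column 2 B) ^^ j) g a b"
    if "a + b = i" for a b
    using ddir_pow_cong_scale[of "i + j" f c g j a b] assms that by simp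
qed simp

lemma pull_lincomb:
  "pull B (\<lambda>a b. s * f a b + t * g a b) = (\<lambda>i j. s * pull B f i j + t * pull B g i j)"
  by (simp add: pull_def ddir_pow_lincomb)

lemma matrix_vector_columns:
  fixes B :: "complex^2^2"
  shows "B *v v = v$1 *s column 1 B + v$2 *s column 2 B"
  by (simp add: matrix_vector_mult_def column_def vec_eq_iff sum_2 algebra_simps)

lemma ddir_pull: "ddir v (pull B u) = pull B (ddir (B *v v) u)"
proof -
  have "ddir v (pull B u) = (\<lambda>i j. v$1 * pull B (ddir (column 1 B) u) i j
      + v$2 * pull B (ddir (column 2 B) u) i j)"
    by (simp add: ddir_def[of v] pull_def funpow_swap1[symmetric] ddir_pow_pow_commute
        ddir_pow_commute fun_eq_iff)
  also have "\<dots> = pull B (ddir (B *v v) u)"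
    by (simp only: matrix_vector_columns ddir_lincomb_vector pull_lincomb)
  finally show ?thesis .
qed

lemma ddir_pow_pull: "(ddir v ^^ i) (pull B u) = pull B ((ddir (B *v v) ^^ i) u)"
  by (induction i) (simp_all add: ddir_pull)

lemma pull_0_0 [simp]: "pull B u 0 0 = u 0 0"
  by (simp add: pull_def)

lemma column_matrix_mult:
  fixes B C :: "complex^2^2"
  shows "column k (C ** B) = C *v column k B"
  by (simp add: column_def matrix_matrix_mult_def matrix_vector_mult_def vec_eq_iff)

lemma pull_pull: "pull B (pull C u) = pull (C ** B) u"
  by (simp add: pull_def[of B] ddir_pow_pull column_matrix_mult pull_def[of "C ** B"])

lemma ddir_pow_basis:
  "(ddir (vector [1, 0]) ^^ i) u a b = u (a + i) b"
  "(ddir (vector [0, 1]) ^^ i) u a b = u a (b + i)"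
  by (induction i arbitrary: a b) (simp_all add: ddir_def)

lemma pull_mat_1 [simp]: "pull (mat 1) u = u"
proof -
  have "column 1 (mat 1 :: complex^2^2) = vector [1, 0]" "column 2 (mat 1 :: complex^2^2) = vector [0, 1]"
    by (simp_all add: column_def mat_def vec_eq_iff forall_2)
  then show ?thesis by (simp add: pull_def fun_eq_iff ddir_pow_basis)
qed

lemma ddir_pow_binomial:
  "(ddir v ^^ m) u a b = (\<Sum>i\<le>m. of_nat (m choose i) * v$1 ^ i * v$2 ^ (m - i) * u (a + i) (b + (m - i)))"
proof (induction m arbitrary: a b)
  case (Suc m)
  let ?f = "\<lambda>i. v$1 ^ i * v$2 ^ (Suc m - i) * u (a + i) (b + (Suc m - i))"
  have "(ddir v ^^ Suc m) u a b =
      v$1 * (\<Sum>i\<le>m. of_nat (m choose i) * v$1 ^ i * v$2 ^ (m - i) * u (Suc a + i) (b + (m - i)))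
    + v$2 * (\<Sum>i\<le>m. of_nat (m choose i) * v$1 ^ i * v$2 ^ (m - i) * u (a + i) (Suc b + (m - i)))"
    by (simp only: funpow.simps comp_apply) (simp only: ddir_def[of v "(ddir v ^^ m) u"] Suc)
  also have "\<dots> = (\<Sum>i\<le>m. of_nat (m choose i) * ?f (Suc i)) + (\<Sum>i\<le>m. of_nat (m choose i) * ?f i)"
    by (auto simp: sum_distrib_left Suc_diff_le algebra_simps intro!: arg_cong2[of _ _ _ _ "(+)"] sum.cong)
  also have "(\<Sum>i\<le>m. of_nat (m choose i) * ?f i) = (\<Sum>i\<le>Suc m. of_nat (m choose i) * ?f i)"
    by simp
  also have "\<dots> = ?f 0 + (\<Sum>i\<le>m. of_nat (m choose Suc i) * ?f (Suc i))"
    by (simp only: sum.atMost_Suc_shift) simp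
  also have "(\<Sum>i\<le>m. of_nat (m choose i) * ?f (Suc i)) + (?f 0 + (\<Sum>i\<le>m. of_nat (m choose Suc i) * ?f (Suc i)))
      = (\<Sum>i\<le>Suc m. of_nat (Suc m choose i) * ?f i)"
    by (simp only: sum.atMost_Suc_shift) (simp add: sum.distrib algebra_simps)
  finally show ?case by (simp add: mult.assoc)
qed simp

lemma ddir_pow_Theta: "(ddir v ^^ m) (snd \<theta>) 0 0 = fact m * Theta m \<theta> v"
  unfolding ddir_pow_binomial Theta_def sum_distrib_left
  by (intro sum.cong refl) (simp add: binomial_fact field_simps)

lemma matrix_inv_eq:
  fixes A B :: "complex^2^2"
  assumes "A ** B = mat 1"
  shows "matrix_inv A = B"
proof -
  have "B ** A = mat 1" using assms matrix_left_right_inverse by blast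
  then have "invertible A" using assms by (auto simp: invertible_def)
  then have "matrix_inv A ** A = mat 1"
    unfolding matrix_inv_def invertible_def by (rule someI2_ex) simp
  then show ?thesis
    using assms by (metis matrix_mul_assoc matrix_mul_lid matrix_mul_rid)
qed

lemma prolong_eq:
  assumes A: "A ** B = mat 1" and \<theta>: "\<theta> \<in> jet_space k"
  shows "prolong k A \<theta> = (A *v base \<theta>, pull B (snd \<theta>))"
proof -
  have B: "matrix_inv A = B" using A by (rule matrix_inv_eq)
  have "B ** A = mat 1" using A matrix_left_right_inverse by blast
  then have BA: "B *v (A *v base \<theta>) = base \<theta>" by (simp add: matrix_vector_mul_assoc)
  obtain h where h: "partials_on UNIV h" "h 0 0 = taylor k \<theta>"
    "\<And>i j. i + j \<le> k \<Longrightarrow> h i j (base \<theta>) = cu i j \<theta>"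
    using partials_on_taylor by blast
  have "(pdx ^^ i) ((pdy ^^ j) (act A (taylor k \<theta>))) (A *v base \<theta>) = pull B (\<lambda>a b. h a b (base \<theta>)) i j" for i j
    using iterated_partials[OF _ partials_on_linear[OF h(1), of B], of "A *v base \<theta>" i j] BA
    by (simp add: act_def B h(2) pull_def ddir_def[abs_def] column_def)
  moreover have "pull B (\<lambda>a b. h a b (base \<theta>)) i j = pull B (snd \<theta>) i j" if "i + j \<le> k" for i j
    using pull_cong_scale[of i j "\<lambda>a b. h a b (base \<theta>)" 1 "snd \<theta>" B] h(3) that by simp
  moreover have "pull B (snd \<theta>) i j = 0" if "k < i + j" for i j
    using pull_cong_scale[of i j "snd \<theta>" 0 "snd \<theta>" B] \<theta> that by (simp add: jet_space_def)
  ultimately show ?thesis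
    by (auto simp: prolong_def jet_of_def fun_eq_iff not_le)
qed

section \<open>Points of the Euler equation\<close>

definition falling :: "nat \<Rightarrow> nat \<Rightarrow> nat \<Rightarrow> complex" where
  "falling n d j = (\<Prod>l<j. of_nat n - of_nat d - of_nat l)"

lemma falling_0 [simp]: "falling n d 0 = 1"
  by (simp add: falling_def)

lemma falling_Suc: "falling n d (Suc j) = (of_nat n - of_nat (d + j)) * falling n d j"
  by (simp add: falling_def algebra_simps)

lemma falling_Suc_shift: "falling n d (Suc j) = (of_nat n - of_nat d) * falling n (Suc d) j"
  unfolding falling_def prod.lessThan_Suc_shift by (simp add: algebra_simps)

lemma euler_eq_iff:
  "\<theta> \<in> euler_eq n k \<longleftrightarrow> \<theta> \<in> jet_space k \<and> base \<theta> \<noteq> 0 \<and>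
     (\<forall>a b. a + b < k \<longrightarrow> ddir (base \<theta>) (snd \<theta>) a b = (of_nat n - of_nat (a + b)) * cu a b \<theta>)"
  unfolding euler_eq_def total_derivatives_euler_expr
  by (auto simp: ddir_def algebra_simps)

lemma euler_eq_jet_space: "\<theta> \<in> euler_eq n k \<Longrightarrow> \<theta> \<in> jet_space k"
  by (simp add: euler_eq_iff)

lemma euler_pow:
  assumes "\<theta> \<in> euler_eq n k" "a + b + j \<le> k"
  shows "(ddir (base \<theta>) ^^ j) (snd \<theta>) a b = falling n (a + b) j * cu a b \<theta>"
  using assms(2)
proof (induction j arbitrary: a b)
  case (Suc j)
  have "(ddir (base \<theta>) ^^ Suc j) (snd \<theta>) a b = falling n (Suc (a + b)) j * ddir (base \<theta>) (snd \<theta>) a b"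
    using Suc.IH[of "Suc a" b] Suc.IH[of a "Suc b"] Suc.prems
    by (simp add: ddir_def[of _ "(ddir (base \<theta>) ^^ j) (snd \<theta>)"])
       (simp add: ddir_def algebra_simps)
  also have "ddir (base \<theta>) (snd \<theta>) a b = (of_nat n - of_nat (a + b)) * cu a b \<theta>"
    using assms(1) Suc.prems by (simp add: euler_eq_iff)
  finally show ?case by (simp add: falling_Suc_shift)
qed simp

lemma euler_pow_pow:
  assumes "\<theta> \<in> euler_eq n k" "i + j \<le> k"
  shows "(ddir v ^^ i) ((ddir (base \<theta>) ^^ j) (snd \<theta>)) 0 0 = falling n i j * (ddir v ^^ i) (snd \<theta>) 0 0"
  by (rule ddir_pow_cong_scale[of i]) (use assms euler_pow in auto)

lemma euler_pull:
  assumes \<theta>: "\<theta> \<in> euler_eq n k" and B: "B *v p = base \<theta>"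
  shows "(p, pull B (snd \<theta>)) \<in> euler_eq n k"
  unfolding euler_eq_iff
proof (intro conjI allI impI)
  show "(p, pull B (snd \<theta>)) \<in> jet_space k"
    using pull_cong_scale[of _ _ "snd \<theta>" 0 "snd \<theta>" B] \<theta> by (auto simp: jet_space_def euler_eq_iff)
  show "base (p, pull B (snd \<theta>)) \<noteq> 0"
    using \<theta> B by (auto simp: euler_eq_iff)
  fix a b assume "a + b < k"
  then have "pull B (ddir (base \<theta>) (snd \<theta>)) a b = (of_nat n - of_nat (a + b)) * pull B (snd \<theta>) a b"
    using \<theta> by (intro pull_cong_scale) (simp only: euler_eq_iff)
  then show "ddir (base (p, pull B (snd \<theta>))) (snd (p, pull B (snd \<theta>))) a b =
      (of_nat n - of_nat (a + b)) * cu a b (p, pull B (snd \<theta>))"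
    by (simp add: ddir_pull B)
qed

lemma prolong_euler:
  assumes "A ** B = mat 1" "\<theta> \<in> euler_eq n k"
  shows "prolong k A \<theta> \<in> euler_eq n k"
proof -
  have "B ** A = mat 1" using assms(1) matrix_left_right_inverse by blast
  then have "B *v (A *v base \<theta>) = base \<theta>" by (simp add: matrix_vector_mul_assoc)
  from euler_pull[OF assms(2) this] show ?thesis
    using prolong_eq[OF assms(1) euler_eq_jet_space[OF assms(2)]] by simp
qed

lemma prolong_prolong:
  assumes "A ** B = mat 1" "A' ** B' = mat 1" "\<theta> \<in> euler_eq n k"
  shows "prolong k A' (prolong k A \<theta>) = prolong k (A' ** A) \<theta>"
proof -
  have "(A' ** A) ** (B ** B') = A' ** (A ** B) ** B'" by (simp add: matrix_mul_assoc)
  then have "(A' ** A) ** (B ** B') = mat 1" using assms by simp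
  moreover have "\<theta> \<in> jet_space k" "prolong k A \<theta> \<in> jet_space k"
    using assms prolong_euler by (blast intro: euler_eq_jet_space)+
  ultimately show ?thesis
    using assms by (simp add: prolong_eq pull_pull matrix_vector_mul_assoc)
qed

lemma prolong_mat_1: "\<theta> \<in> euler_eq n k \<Longrightarrow> prolong k (mat 1) \<theta> = \<theta>"
  using prolong_eq[of "mat 1" "mat 1" \<theta> k] by (simp add: euler_eq_iff)

definition adj2 :: "complex^2^2 \<Rightarrow> complex^2^2" where
  "adj2 A = vector [vector [A$2$2, - A$1$2], vector [- A$2$1, A$1$1]]"

lemma matrix_2_eq_iff:
  fixes A B :: "complex^2^2"
  shows "A = B \<longleftrightarrow> A$1$1 = B$1$1 \<and> A$1$2 = B$1$2 \<and> A$2$1 = B$2$1 \<and> A$2$2 = B$2$2"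
  by (auto simp: vec_eq_iff forall_2)

lemma matrix_mult_2:
  fixes A B :: "complex^2^2"
  shows "(A ** B)$i$j = A$i$1 * B$1$j + A$i$2 * B$2$j"
  by (simp add: matrix_matrix_mult_def sum_2)

lemma matrix_vector_mult_2:
  fixes A :: "complex^2^2"
  shows "(A *v v)$i = A$i$1 * v$1 + A$i$2 * v$2"
  by (simp add: matrix_vector_mult_def sum_2)

lemma mat_1_nth [simp]:
  "(mat 1 :: complex^2^2)$1$1 = 1" "(mat 1 :: complex^2^2)$1$2 = 0"
  "(mat 1 :: complex^2^2)$2$1 = 0" "(mat 1 :: complex^2^2)$2$2 = 1"
  by (simp_all add: mat_def)

lemma adj2_mult:
  assumes "det A = 1"
  shows "A ** adj2 A = mat 1" "adj2 A ** A = mat 1"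
  using assms by (simp_all add: matrix_2_eq_iff matrix_mult_2 adj2_def det_2 algebra_simps)

lemma det_adj2 [simp]: "det (adj2 A) = det A"
  by (simp add: adj2_def det_2 algebra_simps)

section \<open>Generated algebras and polynomial curves\<close>

lemma generated_algebra_diff:
  assumes "f \<in> generated_algebra G" "g \<in> generated_algebra G"
  shows "(\<lambda>x. f x - g x) \<in> generated_algebra G"
  using generated_algebra.add[OF assms(1) generated_algebra.mult[OF generated_algebra.const[of "-1"] assms(2)]]
  by simp

lemma generated_algebra_uminus:
  assumes "f \<in> generated_algebra G"
  shows "(\<lambda>x. - f x) \<in> generated_algebra G"
  using generated_algebra_diff[OF generated_algebra.const[of 0] assms] by simp

lemma generated_algebra_power:
  assumes "f \<in> generated_algebra G"
  shows "(\<lambda>x. f x ^ i) \<in> generated_algebra G"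
  by (induction i) (auto intro: generated_algebra.intros assms)

lemma generated_algebra_cmult:
  assumes "f \<in> generated_algebra G"
  shows "(\<lambda>x. c * f x) \<in> generated_algebra G"
  by (intro generated_algebra.intros assms)

lemmas generated_algebra_closed = generated_algebra.const generated_algebra.add generated_algebra.mult
  generated_algebra_diff generated_algebra_uminus generated_algebra_power generated_algebra_cmult

lemma generated_algebra_ddir_pow:
  assumes v: "\<And>l. (\<lambda>x. v x $ l) \<in> generated_algebra G"
    and h: "\<And>a b. a + b = N \<Longrightarrow> (\<lambda>x. h x a b) \<in> generated_algebra G"
    and "i + a + b = N"
  shows "(\<lambda>x. (ddir (v x) ^^ i) (h x) a b) \<in> generated_algebra G"
  using assms(3)
proof (induction i arbitrary: a b)
  case (Suc i)
  from Suc.IH[of "Suc a" b] Suc.IH[of a "Suc b"] Suc.prems show ?case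
    by (simp add: ddir_def[of _ "(ddir _ ^^ i) _"]) (intro generated_algebra_closed v; simp)
qed (simp add: h)

lemma generated_algebra_pull:
  assumes B: "\<And>l m. (\<lambda>x. B x $ l $ m) \<in> generated_algebra G"
    and h: "\<And>a b. a + b = i + j \<Longrightarrow> (\<lambda>x. h x a b) \<in> generated_algebra G"
  shows "(\<lambda>x. pull (B x) (h x) i j) \<in> generated_algebra G"
  unfolding pull_def
proof (rule generated_algebra_ddir_pow[of _ _ i])
  show "(\<lambda>x. column 1 (B x) $ l) \<in> generated_algebra G" for l
    using B by (simp add: column_def)
  show "(\<lambda>x. (ddir (column 2 (B x)) ^^ j) (h x) a b) \<in> generated_algebra G" if "a + b = i" for a b
    by (rule generated_algebra_ddir_pow[of _ _ "i + j"]) (use B h that in \<open>auto simp: column_def\<close>)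
qed simp

lemma clear_denominators:
  assumes T: "T \<in> generated_algebra H"
    and G: "\<And>g. g \<in> G \<Longrightarrow> \<exists>M. \<exists>R \<in> generated_algebra H. \<forall>x\<in>S. T x ^ M * g (\<phi> x) = R x"
    and f: "f \<in> generated_algebra G"
  shows "\<exists>M. \<exists>R \<in> generated_algebra H. \<forall>x\<in>S. T x ^ M * f (\<phi> x) = R x"
  using f
proof induction
  case (const c)
  show ?case by (rule exI[of _ 0], rule bexI[of _ "\<lambda>_. c"]) (auto intro: generated_algebra.const)
next
  case (gen g)
  then show ?case by (rule G)
next
  case (add f g)
  then obtain M R M' R' where R: "R \<in> generated_algebra H" "\<And>x. x \<in> S \<Longrightarrow> T x ^ M * f (\<phi> x) = R x"
    "R' \<in> generated_algebra H" "\<And>x. x \<in> S \<Longrightarrow> T x ^ M' * g (\<phi> x) = R' x" by blast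
  have "(\<lambda>x. T x ^ M' * R x + T x ^ M * R' x) \<in> generated_algebra H"
    by (intro generated_algebra_closed T R)
  then show ?case
    by (intro exI[of _ "M + M'"] bexI[rotated])
       (auto simp: R(2,4)[symmetric] power_add algebra_simps)
next
  case (mult f g)
  then obtain M R M' R' where R: "R \<in> generated_algebra H" "\<And>x. x \<in> S \<Longrightarrow> T x ^ M * f (\<phi> x) = R x"
    "R' \<in> generated_algebra H" "\<And>x. x \<in> S \<Longrightarrow> T x ^ M' * g (\<phi> x) = R' x" by blast
  have "(\<lambda>x. R x * R' x) \<in> generated_algebra H"
    by (intro generated_algebra_closed R)
  then show ?case
    by (intro exI[of _ "M + M'"] bexI[rotated])
       (auto simp: R(2,4)[symmetric] power_add algebra_simps)
qed

lemma generated_algebra_id_poly: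
  assumes "f \<in> generated_algebra {\<lambda>t. t}"
  shows "\<exists>p. \<forall>t. f t = poly p t"
  using assms
proof induction
  case (const c)
  show ?case by (rule exI[of _ "[:c:]"]) simp
next
  case (gen g)
  then show ?case by (intro exI[of _ "[:0, 1:]"]) auto
next
  case (add f g)
  then show ?case by (metis poly_add)
next
  case (mult f g)
  then show ?case by (metis poly_mult)
qed

lemma jet_polys_intros:
  "cx \<in> jet_polys k" "cy \<in> jet_polys k" "i + j \<le> k \<Longrightarrow> cu i j \<in> jet_polys k"
  by (auto simp: jet_polys_def intro: generated_algebra.gen)

lemma jet_polys_mono:
  assumes "f \<in> jet_polys k" "k \<le> m"
  shows "f \<in> jet_polys m"
  using assms(1) unfolding jet_polys_def[of k]
proof induction
  case (gen g)
  then show ?case using assms(2) by (auto intro!: jet_polys_intros)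
qed (auto simp: jet_polys_def intro: generated_algebra.intros)

lemma jet_polys_trunc:
  assumes "f \<in> jet_polys k"
  shows "f (trunc k \<theta>) = f \<theta>"
  using assms unfolding jet_polys_def
  by induction (auto simp: trunc_def)

section \<open>Density of principal open subsets\<close>

text \<open>The \<open>k\<close>-jet at \<open>(1, 0)\<close> with \<open>u\<^sub>0\<^sub>b = c\<^sub>b\<close>; the Euler equation determines the other coordinates.\<close>

definition sigma :: "nat \<Rightarrow> nat \<Rightarrow> (nat \<Rightarrow> complex) \<Rightarrow> jet" where
  "sigma n k c = (vector [1, 0], \<lambda>a b. if a + b \<le> k then falling n b a * c b else 0)"

lemma sigma_cong: "(\<And>b. b \<le> k \<Longrightarrow> c b = c' b) \<Longrightarrow> sigma n k c = sigma n k c'"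
  by (auto simp: sigma_def fun_eq_iff)

lemma sigma_euler: "sigma n k c \<in> euler_eq n k"
  by (auto simp: euler_eq_iff jet_space_def sigma_def ddir_def falling_Suc vec_eq_iff forall_2 add.commute)

lemma euler_eq_sigma:
  assumes "\<theta> \<in> euler_eq n k" "base \<theta> = vector [1, 0]"
  shows "\<theta> = sigma n k (\<lambda>b. cu 0 b \<theta>)"
proof -
  have "cu a b \<theta> = falling n b a * cu 0 b \<theta>" if "a + b \<le> k" for a b
    using euler_pow[OF assms(1), of 0 b a] that by (simp add: assms(2) ddir_pow_basis add.commute)
  moreover have "cu a b \<theta> = 0" if "\<not> a + b \<le> k" for a b
    using euler_eq_jet_space[OF assms(1)] that by (simp add: jet_space_def)
  ultimately have "snd \<theta> = snd (sigma n k (\<lambda>b. cu 0 b \<theta>))"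
    unfolding sigma_def snd_conv by (intro ext) (simp only: split: if_split, blast)
  then show ?thesis
    using assms(2) by (intro prod_eqI) (simp_all add: sigma_def)
qed

lemma ex_SL2_transitive:
  fixes p :: "complex^2"
  assumes "p \<noteq> 0"
  shows "\<exists>A :: complex^2^2. det A = 1 \<and> A *v vector [1, 0] = p"
proof (cases "p$1 = 0")
  case True
  then have "p$2 \<noteq> 0" using assms by (auto simp: vec_eq_iff forall_2)
  then show ?thesis using True
    by (intro exI[of _ "vector [vector [p$1, - 1 / p$2], vector [p$2, 0]]"])
       (auto simp: det_2 vec_eq_iff forall_2 matrix_vector_mult_2)
next
  case False
  then show ?thesis
    by (intro exI[of _ "vector [vector [p$1, 0], vector [p$2, 1 / p$1]]"])
       (auto simp: det_2 vec_eq_iff forall_2 matrix_vector_mult_2)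
qed

lemma euler_normal_form:
  assumes "\<theta> \<in> euler_eq n k"
  shows "\<exists>A c. det A = 1 \<and> \<theta> = (A *v vector [1, 0], pull (adj2 A) (snd (sigma n k c)))"
proof -
  obtain A where A: "det A = 1" "A *v vector [1, 0] = base \<theta>"
    using ex_SL2_transitive[of "base \<theta>"] assms unfolding euler_eq_iff by blast
  define \<theta>' where "\<theta>' = (vector [1, 0] :: complex^2, pull A (snd \<theta>))"
  have "\<theta>' = sigma n k (\<lambda>b. cu 0 b \<theta>')"
    by (rule euler_eq_sigma) (use euler_pull[OF assms A(2)] in \<open>auto simp: \<theta>'_def\<close>)
  then have "pull A (snd \<theta>) = snd (sigma n k (\<lambda>b. cu 0 b \<theta>'))"
    by (metis \<theta>'_def snd_conv)
  then have "pull (adj2 A) (snd (sigma n k (\<lambda>b. cu 0 b \<theta>'))) = snd \<theta>"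
    using pull_pull[of "adj2 A" A "snd \<theta>"] by (simp add: adj2_mult A(1))
  then show ?thesis using A by (metis prod.collapse)
qed

lemma sigma_trunc: "l \<le> m \<Longrightarrow> trunc l (sigma n m c) = sigma n l c"
  by (auto simp: trunc_def sigma_def fun_eq_iff)

lemma trunc_pull: "trunc l (q, pull B (snd \<theta>)) = (q, pull B (snd (trunc l \<theta>)))"
proof -
  have "pull B (snd (trunc l \<theta>)) a b = (if a + b \<le> l then 1 else 0) * pull B (snd \<theta>) a b" for a b
    by (rule pull_cong_scale) (auto simp: trunc_def)
  then show ?thesis by (auto simp: trunc_def[of l "(q, _)"] fun_eq_iff)
qed

lemma trunc_euler:
  assumes "\<theta> \<in> euler_eq n m" "l \<le> m"
  shows "trunc l \<theta> \<in> euler_eq n l"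
  using assms by (auto simp: euler_eq_iff trunc_def jet_space_def ddir_def)

lemma trunc_euler_surj:
  assumes "\<theta> \<in> euler_eq n l" "l \<le> m"
  shows "\<exists>\<theta>'\<in>euler_eq n m. trunc l \<theta>' = \<theta>"
proof -
  obtain A c where A: "det A = 1" "\<theta> = (A *v vector [1, 0], pull (adj2 A) (snd (sigma n l c)))"
    using euler_normal_form[OF assms(1)] by blast
  let ?\<theta> = "(A *v vector [1, 0], pull (adj2 A) (snd (sigma n m c)))"
  have "trunc l ?\<theta> = \<theta>"
    unfolding A(2) trunc_pull sigma_trunc[OF assms(2)] ..
  moreover have "?\<theta> \<in> euler_eq n m"
    by (rule euler_pull[OF sigma_euler]) (simp add: matrix_vector_mul_assoc adj2_mult A(1) sigma_def)
  ultimately show ?thesis by blast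
qed

definition nonvanishing :: "nat \<Rightarrow> nat \<Rightarrow> (jet \<Rightarrow> complex) \<Rightarrow> bool" where
  "nonvanishing n k f \<longleftrightarrow> f \<in> jet_polys k \<and> (\<exists>\<theta>\<in>euler_eq n k. f \<theta> \<noteq> 0)"

text \<open>
  Two points of the Euler equation are joined by a rational curve in it: move the coordinates of
  the normal form and the matrix \<open>B\<close> bringing a point to normal form along straight lines. The
  base point is \<open>B\<inverse> e\<^sub>1\<close>, so \<open>det B\<close> is the only denominator.
\<close>

lemma nonvanishing_mult:
  assumes "nonvanishing n k f" "nonvanishing n k g"
  shows "nonvanishing n k (\<lambda>\<theta>. f \<theta> * g \<theta>)"
proof -
  from assms obtain \<theta>1 \<theta>2 where \<theta>: "\<theta>1 \<in> euler_eq n k" "f \<theta>1 \<noteq> 0" "\<theta>2 \<in> euler_eq n k" "g \<theta>2 \<noteq> 0"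
    by (auto simp: nonvanishing_def)
  obtain A1 c1 A2 c2 where A: "det A1 = 1" "\<theta>1 = (A1 *v vector [1, 0], pull (adj2 A1) (snd (sigma n k c1)))"
    "det A2 = 1" "\<theta>2 = (A2 *v vector [1, 0], pull (adj2 A2) (snd (sigma n k c2)))"
    using euler_normal_form \<theta> by metis
  define B :: "complex \<Rightarrow> complex^2^2" where
    "B t = (\<chi> i j. (1 - t) * adj2 A1 $ i $ j + t * adj2 A2 $ i $ j)" for t
  define c where "c t b = (1 - t) * c1 b + t * c2 b" for t b
  define p :: "complex \<Rightarrow> complex^2" where "p t = vector [B t $ 2 $ 2 / det (B t), - (B t $ 2 $ 1) / det (B t)]" for t
  define \<gamma> where "\<gamma> t = (p t, pull (B t) (snd (sigma n k (c t))))" for t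
  let ?G = "generated_algebra {\<lambda>t::complex. t}"
  have t: "(\<lambda>t. t) \<in> ?G" by (rule generated_algebra.gen) simp
  have B: "(\<lambda>t. B t $ i $ j) \<in> ?G" for i j
    unfolding B_def vec_lambda_beta by (intro generated_algebra_closed t)
  have \<delta>: "(\<lambda>t. det (B t)) \<in> ?G"
    unfolding det_2 by (intro generated_algebra_closed B)
  have u: "(\<lambda>t. cu i j (\<gamma> t)) \<in> ?G" for i j
  proof -
    have "(\<lambda>t. snd (sigma n k (c t)) a b) \<in> ?G" for a b
      unfolding sigma_def c_def
      by (cases "a + b \<le> k") (simp_all add: generated_algebra.const, intro generated_algebra_closed t)
    then show ?thesis
      unfolding \<gamma>_def snd_conv by (intro generated_algebra_pull B)
  qed
  have curve: "\<exists>M. \<exists>q. \<forall>t. det (B t) \<noteq> 0 \<longrightarrow> det (B t) ^ M * h (\<gamma> t) = poly q t"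
    if "h \<in> jet_polys k" for h
  proof -
    have "\<exists>M. \<exists>R \<in> ?G. \<forall>t\<in>{t. det (B t) \<noteq> 0}. det (B t) ^ M * h (\<gamma> t) = R t"
    proof (rule clear_denominators[OF \<delta> _ that[unfolded jet_polys_def]])
      fix g assume "g \<in> {cx, cy} \<union> {cu i j |i j. i + j \<le> k}"
      then consider "g = cx" | "g = cy" | i j where "g = cu i j" by blast
      then show "\<exists>M. \<exists>R \<in> ?G. \<forall>t\<in>{t. det (B t) \<noteq> 0}. det (B t) ^ M * g (\<gamma> t) = R t"
      proof cases
        case 1
        then show ?thesis
          by (intro exI[of _ 1] bexI[OF _ B[of 2 2]]) (simp add: \<gamma>_def p_def)
      next
        case 2
        then show ?thesis
          by (intro exI[of _ 1] bexI[OF _ generated_algebra_uminus[OF B[of 2 1]]]) (simp add: \<gamma>_def p_def)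
      next
        case 3
        then show ?thesis
          by (intro exI[of _ 0] bexI[OF _ u[of i j]]) simp
      qed
    qed
    then obtain M R where R: "R \<in> ?G" "\<And>t. det (B t) \<noteq> 0 \<Longrightarrow> det (B t) ^ M * h (\<gamma> t) = R t"
      by blast
    obtain q where "\<forall>t. R t = poly q t" using generated_algebra_id_poly[OF R(1)] by blast
    with R(2) show ?thesis by auto
  qed
  obtain d where d: "\<And>t. det (B t) = poly d t" using generated_algebra_id_poly[OF \<delta>] by blast
  obtain M1 q1 where q1: "\<And>t. det (B t) \<noteq> 0 \<Longrightarrow> det (B t) ^ M1 * f (\<gamma> t) = poly q1 t"
    using curve assms(1) unfolding nonvanishing_def by blast
  obtain M2 q2 where q2: "\<And>t. det (B t) \<noteq> 0 \<Longrightarrow> det (B t) ^ M2 * g (\<gamma> t) = poly q2 t"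
    using curve assms(2) unfolding nonvanishing_def by blast
  have B01: "B 0 = adj2 A1" "B 1 = adj2 A2" by (simp_all add: B_def vec_eq_iff)
  have "\<gamma> 0 = \<theta>1"
    unfolding A(2) \<gamma>_def p_def B01 c_def
    by (simp add: A(1)) (simp add: adj2_def vec_eq_iff forall_2 matrix_vector_mult_2)
  then have "poly q1 0 \<noteq> 0" using q1[of 0] \<theta>(2) by (simp add: B01 A(1))
  moreover have "\<gamma> 1 = \<theta>2"
    unfolding A(4) \<gamma>_def p_def B01 c_def
    by (simp add: A(3)) (simp add: adj2_def vec_eq_iff forall_2 matrix_vector_mult_2)
  then have "poly q2 1 \<noteq> 0" using q2[of 1] \<theta>(4) by (simp add: B01 A(3))
  moreover have "poly d 0 \<noteq> 0" using d[of 0] by (simp add: B01 A(1))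
  ultimately have "d * q1 * q2 \<noteq> 0" by auto
  then have "finite {t. poly (d * q1 * q2) t = 0}" by (rule poly_roots_finite)
  then obtain t where "poly (d * q1 * q2) t \<noteq> 0"
    using infinite_UNIV_char_0[where 'a = complex] by (metis (mono_tags) UNIV_eq_I mem_Collect_eq)
  then have t: "det (B t) \<noteq> 0" "f (\<gamma> t) * g (\<gamma> t) \<noteq> 0"
    using q1[of t] q2[of t] d[of t] by auto
  have "B t *v p t = vector [1, 0]"
    using t(1) by (simp add: p_def vec_eq_iff forall_2 matrix_vector_mult_2 field_simps)
       (simp add: det_2 algebra_simps)
  then have "\<gamma> t \<in> euler_eq n k"
    unfolding \<gamma>_def by (intro euler_pull[OF sigma_euler]) (simp add: sigma_def)
  moreover have "(\<lambda>\<theta>. f \<theta> * g \<theta>) \<in> jet_polys k"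
    using assms by (auto simp: nonvanishing_def jet_polys_def intro: generated_algebra.mult)
  ultimately show ?thesis using t(2) unfolding nonvanishing_def by blast
qed

lemma nonvanishing_const: "c \<noteq> 0 \<Longrightarrow> nonvanishing n k (\<lambda>_. c)"
  using sigma_euler[of n k] unfolding nonvanishing_def jet_polys_def
  by (auto simp del: split_paired_Ex intro: generated_algebra.const)

lemma nonvanishing_lift:
  assumes "nonvanishing n k f" "k \<le> m"
  shows "nonvanishing n m f"
proof -
  obtain \<theta> where "f \<in> jet_polys k" "\<theta> \<in> euler_eq n k" "f \<theta> \<noteq> 0"
    using assms(1) by (auto simp: nonvanishing_def)
  moreover from this obtain \<theta>' where "\<theta>' \<in> euler_eq n m" "trunc k \<theta>' = \<theta>"
    using trunc_euler_surj assms(2) by blast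
  ultimately show ?thesis
    using jet_polys_trunc[of f k \<theta>'] jet_polys_mono[of f k m] assms(2)
    unfolding nonvanishing_def by auto
qed

lemma rat_eq_iff_nonvanishing:
  "rat_eq n k f g \<longleftrightarrow> (\<exists>D. nonvanishing n k D \<and> (\<forall>\<theta>\<in>euler_eq n k. D \<theta> \<noteq> 0 \<longrightarrow> f \<theta> = g \<theta>))"
  by (auto simp: rat_eq_def nonvanishing_def)

lemma jet_polys_prolong:
  assumes A: "det A = 1" and f: "f \<in> jet_polys k"
  shows "\<exists>g\<in>jet_polys k. \<forall>\<theta>\<in>euler_eq n k. g \<theta> = f (prolong k A \<theta>)"
proof -
  have *: "(\<lambda>_. 1) \<in> generated_algebra ({cx, cy} \<union> {cu i j |i j. i + j \<le> k})"
    by (rule generated_algebra.const)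
  have "\<exists>M. \<exists>R\<in>jet_polys k. \<forall>\<theta>\<in>euler_eq n k. (1 :: complex) ^ M * f (prolong k A \<theta>) = R \<theta>"
    unfolding jet_polys_def
  proof (rule clear_denominators[OF * _ f[unfolded jet_polys_def]], fold jet_polys_def)
    fix g assume g: "g \<in> {cx, cy} \<union> {cu i j |i j. i + j \<le> k}"
    define R where "R \<theta> = g (A *v base \<theta>, pull (adj2 A) (snd \<theta>))" for \<theta>
    have "(\<lambda>\<theta>. (A *v base \<theta>) $ l) \<in> jet_polys k" for l
      using jet_polys_intros[of k] unfolding matrix_vector_mult_2 jet_polys_def
      by (intro generated_algebra_closed)
    moreover have "(\<lambda>\<theta>. pull (adj2 A) (snd \<theta>) i j) \<in> jet_polys k" if "i + j \<le> k" for i j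
      using jet_polys_intros(3) that unfolding jet_polys_def
      by (intro generated_algebra_pull generated_algebra.const) auto
    ultimately have "R \<in> jet_polys k" using g unfolding R_def by auto
    moreover have "R \<theta> = g (prolong k A \<theta>)" if "\<theta> \<in> euler_eq n k" for \<theta>
      using prolong_eq[OF adj2_mult(1)[OF A] euler_eq_jet_space[OF that]] by (simp add: R_def)
    ultimately show "\<exists>M. \<exists>R\<in>jet_polys k. \<forall>\<theta>\<in>euler_eq n k. 1 ^ M * g (prolong k A \<theta>) = R \<theta>"
      by (intro exI[of _ 0] bexI[of _ R]) auto
  qed
  then show ?thesis by (metis mult_1 power_one)
qed

text \<open>
  Invariance holds off an exceptional set that depends on \<open>A\<close>; clearing denominators removes it.
\<close>

lemma invariant_cross_identity:
  assumes A: "det A = 1" and F: "rat_eq n k (F \<circ> prolong k A) F"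
    and PQ: "P \<in> jet_polys k" "nonvanishing n k Q" "rat_eq n k F (\<lambda>\<theta>. P \<theta> / Q \<theta>)"
    and \<theta>: "\<theta> \<in> euler_eq n k"
  shows "P (prolong k A \<theta>) * Q \<theta> = P \<theta> * Q (prolong k A \<theta>)"
proof (rule ccontr)
  assume neq: "P (prolong k A \<theta>) * Q \<theta> \<noteq> P \<theta> * Q (prolong k A \<theta>)"
  obtain D where D: "nonvanishing n k D"
    "\<And>\<theta>. \<theta> \<in> euler_eq n k \<Longrightarrow> D \<theta> \<noteq> 0 \<Longrightarrow> F \<theta> = P \<theta> / Q \<theta>"
    using PQ(3) by (auto simp: rat_eq_iff_nonvanishing)
  obtain E where E: "nonvanishing n k E"
    "\<And>\<theta>. \<theta> \<in> euler_eq n k \<Longrightarrow> E \<theta> \<noteq> 0 \<Longrightarrow> F (prolong k A \<theta>) = F \<theta>"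
    using F by (auto simp: rat_eq_iff_nonvanishing)
  have pull_nv: "\<exists>g. nonvanishing n k g \<and> (\<forall>\<theta>\<in>euler_eq n k. g \<theta> = f (prolong k A \<theta>))"
    if f: "nonvanishing n k f" for f
  proof -
    from f obtain \<theta> where \<theta>: "\<theta> \<in> euler_eq n k" "f \<theta> \<noteq> 0" by (auto simp: nonvanishing_def)
    have inv: "adj2 A ** A = mat 1" "A ** adj2 A = mat 1" using A by (simp_all add: adj2_mult)
    have e: "prolong k (adj2 A) \<theta> \<in> euler_eq n k" by (rule prolong_euler[OF inv(1) \<theta>(1)])
    have "prolong k A (prolong k (adj2 A) \<theta>) = \<theta>"
      using prolong_prolong[OF inv \<theta>(1)] prolong_mat_1[OF \<theta>(1)] by (simp add: inv)
    moreover obtain g where "g \<in> jet_polys k" "\<And>\<theta>. \<theta> \<in> euler_eq n k \<Longrightarrow> g \<theta> = f (prolong k A \<theta>)"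
      using jet_polys_prolong[OF A] f unfolding nonvanishing_def by blast
    ultimately show ?thesis
      using e \<theta>(2) unfolding nonvanishing_def by metis
  qed
  obtain D' where D': "nonvanishing n k D'" "\<And>\<theta>. \<theta> \<in> euler_eq n k \<Longrightarrow> D' \<theta> = D (prolong k A \<theta>)"
    using pull_nv[OF D(1)] by blast
  obtain Q' where Q': "nonvanishing n k Q'" "\<And>\<theta>. \<theta> \<in> euler_eq n k \<Longrightarrow> Q' \<theta> = Q (prolong k A \<theta>)"
    using pull_nv[OF PQ(2)] by blast
  obtain P' where P': "P' \<in> jet_polys k" "\<And>\<theta>. \<theta> \<in> euler_eq n k \<Longrightarrow> P' \<theta> = P (prolong k A \<theta>)"
    using jet_polys_prolong[OF A PQ(1)] by blast
  have "(\<lambda>\<theta>. P' \<theta> * Q \<theta> - P \<theta> * Q' \<theta>) \<in> jet_polys k"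
    using P'(1) PQ(1,2) Q'(1) unfolding nonvanishing_def jet_polys_def by (intro generated_algebra_closed) auto
  then have "nonvanishing n k (\<lambda>\<theta>. P' \<theta> * Q \<theta> - P \<theta> * Q' \<theta>)"
    using neq \<theta> P'(2) Q'(2) unfolding nonvanishing_def by (metis right_minus_eq)
  from nonvanishing_mult[OF this nonvanishing_mult[OF nonvanishing_mult[OF D(1) E(1)]
      nonvanishing_mult[OF D'(1) nonvanishing_mult[OF PQ(2) Q'(1)]]]]
  obtain \<eta> where \<eta>: "\<eta> \<in> euler_eq n k" "P' \<eta> * Q \<eta> - P \<eta> * Q' \<eta> \<noteq> 0"
    "D \<eta> \<noteq> 0" "E \<eta> \<noteq> 0" "D' \<eta> \<noteq> 0" "Q \<eta> \<noteq> 0" "Q' \<eta> \<noteq> 0"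
    unfolding nonvanishing_def mult_eq_0_iff de_Morgan_disj by blast
  have "prolong k A \<eta> \<in> euler_eq n k" by (rule prolong_euler[OF adj2_mult(1)[OF A] \<eta>(1)])
  then have "P' \<eta> / Q' \<eta> = P \<eta> / Q \<eta>"
    using D(2)[of "prolong k A \<eta>"] D(2)[OF \<eta>(1,3)] E(2)[OF \<eta>(1,4)] \<eta> by (simp add: P'(2) Q'(2) D'(2))
  then show False using \<eta> by (simp add: field_simps)
qed

section \<open>The invariants in the coframe\<close>

definition skew :: "(nat \<Rightarrow> nat \<Rightarrow> complex) \<Rightarrow> complex^2" where
  "skew u = vector [u 0 1, - u 1 0]"

text \<open>\<open>contr i\<close> is \<open>T\<^sub>i\<close>, by lemma \<open>ddir_pow_Theta\<close>.\<close>

definition contr :: "nat \<Rightarrow> jet \<Rightarrow> complex" where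
  "contr i \<theta> = (ddir (skew (snd \<theta>)) ^^ i) (snd \<theta>) 0 0"

lemma contr_0 [simp]: "contr 0 \<theta> = cu 0 0 \<theta>"
  by (simp add: contr_def)

lemma skew_pull:
  assumes "det A = 1"
  shows "skew (pull (adj2 A) u) = A *v skew u"
  by (simp add: skew_def pull_def ddir_def column_def adj2_def vec_eq_iff forall_2 matrix_vector_mult_2 algebra_simps)

lemma contr_prolong:
  assumes "det A = 1" "\<theta> \<in> euler_eq n k"
  shows "contr i (prolong k A \<theta>) = contr i \<theta>"
  using prolong_eq[OF adj2_mult(1)[OF assms(1)] euler_eq_jet_space[OF assms(2)]]
  by (simp add: contr_def skew_pull ddir_pow_pull matrix_vector_mul_assoc adj2_mult assms(1))

lemma contr_jet_polys: "contr i \<in> jet_polys (i + j)"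
proof (cases "i = 0")
  case True
  then show ?thesis
    using jet_polys_intros(3)[of 0 0 j] by (simp add: contr_def[abs_def])
next
  case False
  have v: "(\<lambda>\<theta>. skew (snd \<theta>) $ l) \<in> jet_polys (i + j)" for l
    using jet_polys_intros(3)[of 1 0 "i + j"] jet_polys_intros(3)[of 0 1 "i + j"] False exhaust_2[of l]
    by (auto simp: skew_def jet_polys_def intro: generated_algebra_uminus)
  show ?thesis
    unfolding contr_def[abs_def] jet_polys_def
    by (rule generated_algebra_ddir_pow[of _ _ i])
       (use v jet_polys_intros(3) in \<open>auto simp: jet_polys_def\<close>)
qed

text \<open>
  On the Euler equation \<open>Hess u \<cdot> p = (n - 1) \<nabla>u\<close> and \<open>p \<cdot> \<nabla>u = n u\<close>, which turns the coframe
  into \<open>(y dx - x dy) / (n u)\<close> and \<open>(n - 1) du / (2 n u)\<close>.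
\<close>

lemma euler_coframe:
  assumes \<theta>: "\<theta> \<in> euler_eq n k" and k: "k \<ge> 2" and n: "n \<ge> 2" and J: "J21 \<theta> \<noteq> 0"
  shows "cu 0 0 \<theta> \<noteq> 0"
    and "omega1 \<theta> v = (cy \<theta> * v$1 - cx \<theta> * v$2) / (of_nat n * cu 0 0 \<theta>)"
    and "omega2 \<theta> v = (of_nat n - 1) / (2 * of_nat n * cu 0 0 \<theta>) * (cu 1 0 \<theta> * v$1 + cu 0 1 \<theta> * v$2)"
proof -
  have e: "\<And>a b. a + b < k \<Longrightarrow> cx \<theta> * cu (Suc a) b \<theta> + cy \<theta> * cu a (Suc b) \<theta> = (of_nat n - of_nat (a + b)) * cu a b \<theta>"
    using \<theta> unfolding euler_eq_iff ddir_def by blast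
  define N :: complex where "N = of_nat n"
  define x y u p q r s t where d: "x = cx \<theta>" "y = cy \<theta>" "u = cu 0 0 \<theta>" "p = cu 1 0 \<theta>" "q = cu 0 1 \<theta>"
    "r = cu 2 0 \<theta>" "s = cu 1 1 \<theta>" "t = cu 0 2 \<theta>"
  have e0: "x * p + y * q = N * u" using e[of 0 0] k by (simp add: d N_def)
  have e1: "x * r + y * s = (N - 1) * p" using e[of 1 0] k by (simp add: d N_def numeral_2_eq_2)
  have e2: "x * s + y * t = (N - 1) * q" using e[of 0 1] k by (simp add: d N_def numeral_2_eq_2)
  have De: "Delta2 \<theta> = r * t - s\<^sup>2" by (simp add: Delta2_def d)
  have Je: "J21 \<theta> = q\<^sup>2 * r - 2 * p * q * s + p\<^sup>2 * t" by (simp add: J21_def d)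
  have "(N - 1) * (r * q - s * p) = r * ((N - 1) * q) - s * ((N - 1) * p)" by (simp add: algebra_simps)
  also have "\<dots> = y * Delta2 \<theta>"
    unfolding e1[symmetric] e2[symmetric] De by (simp add: algebra_simps power2_eq_square)
  finally have a: "(N - 1) * (r * q - s * p) = y * Delta2 \<theta>" .
  have "(N - 1) * (t * p - s * q) = t * ((N - 1) * p) - s * ((N - 1) * q)" by (simp add: algebra_simps)
  also have "\<dots> = x * Delta2 \<theta>"
    unfolding e1[symmetric] e2[symmetric] De by (simp add: algebra_simps power2_eq_square)
  finally have b: "(N - 1) * (t * p - s * q) = x * Delta2 \<theta>" .
  have "(N - 1) * J21 \<theta> = q * ((N - 1) * (r * q - s * p)) + p * ((N - 1) * (t * p - s * q))"
    unfolding Je by (simp add: algebra_simps power2_eq_square)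
  also have "\<dots> = Delta2 \<theta> * (x * p + y * q)" unfolding a b by (simp add: algebra_simps)
  finally have c: "(N - 1) * J21 \<theta> = N * u * Delta2 \<theta>" by (simp add: e0)
  have "N \<noteq> of_nat 1" unfolding N_def of_nat_eq_iff using n by simp
  then have N: "N - 1 \<noteq> 0" "N \<noteq> 0" using n by (auto simp: N_def)
  with c J show u: "cu 0 0 \<theta> \<noteq> 0" by (auto simp: d)
  have u': "u \<noteq> 0" using u by (simp add: d)
  have D0: "Delta2 \<theta> \<noteq> 0" using c N J by auto
  have J': "J21 \<theta> = N * u * Delta2 \<theta> / (N - 1)" using c N by (simp add: field_simps)
  have a': "r * q - s * p = y * Delta2 \<theta> / (N - 1)" using a N by (simp add: field_simps)
  have b': "t * p - s * q = x * Delta2 \<theta> / (N - 1)" using b N by (simp add: field_simps)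
  have "omega1 \<theta> v = (r * q - s * p) / J21 \<theta> * v$1 - (t * p - s * q) / J21 \<theta> * v$2"
    by (simp add: omega1_def d)
  also have "\<dots> = (y * v$1 - x * v$2) / (N * u)"
    unfolding a' b' J' using N(1) D0 by (simp add: diff_divide_distrib)
  finally show "omega1 \<theta> v = (cy \<theta> * v$1 - cx \<theta> * v$2) / (of_nat n * cu 0 0 \<theta>)"
    by (simp add: d N_def)
  have "Delta2 \<theta> / (2 * J21 \<theta>) = (N - 1) / (2 * N * u)"
    unfolding J' using N(1) D0 by simp
  then show "omega2 \<theta> v = (of_nat n - 1) / (2 * of_nat n * cu 0 0 \<theta>) * (cu 1 0 \<theta> * v$1 + cu 0 1 \<theta> * v$2)"
    by (simp add: omega2_def d N_def)
qed

lemma euler_decomposition: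
  assumes \<theta>: "\<theta> \<in> euler_eq n k" and k: "k \<ge> 2" and n: "n \<ge> 2" and J: "J21 \<theta> \<noteq> 0"
  shows "v = omega1 \<theta> v *s skew (snd \<theta>) + (2 / (of_nat n - 1) * omega2 \<theta> v) *s base \<theta>"
proof -
  define N :: complex where "N = of_nat n"
  have "N \<noteq> of_nat 1" unfolding N_def of_nat_eq_iff using n by simp
  then have N: "N - 1 \<noteq> 0" "N \<noteq> 0" using n by (auto simp: N_def)
  note cof = euler_coframe[OF \<theta> k n J, folded N_def]
  have e: "N * cu 0 0 \<theta> = cx \<theta> * cu 1 0 \<theta> + cy \<theta> * cu 0 1 \<theta>"
    using euler_pow[OF \<theta>, of 0 0 1] k by (simp add: ddir_def falling_def N_def)
  define M where "M = N * cu 0 0 \<theta>"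
  have M: "M \<noteq> 0" using N cof(1) by (simp add: M_def)
  have o2: "2 / (N - 1) * omega2 \<theta> v = (cu 1 0 \<theta> * v$1 + cu 0 1 \<theta> * v$2) / M"
    using N cof(1) unfolding cof(3) M_def by (simp add: field_simps)
  have "(cy \<theta> * v$1 - cx \<theta> * v$2) * cu 0 1 \<theta> + (cu 1 0 \<theta> * v$1 + cu 0 1 \<theta> * v$2) * cx \<theta> = M * v$1"
    "- (cy \<theta> * v$1 - cx \<theta> * v$2) * cu 1 0 \<theta> + (cu 1 0 \<theta> * v$1 + cu 0 1 \<theta> * v$2) * cy \<theta> = M * v$2"
    unfolding M_def e by (simp_all add: algebra_simps)
  then have "v$1 = (cy \<theta> * v$1 - cx \<theta> * v$2) / M * cu 0 1 \<theta> + (cu 1 0 \<theta> * v$1 + cu 0 1 \<theta> * v$2) / M * cx \<theta>"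
    "v$2 = - ((cy \<theta> * v$1 - cx \<theta> * v$2) / M * cu 1 0 \<theta>) + (cu 1 0 \<theta> * v$1 + cu 0 1 \<theta> * v$2) / M * cy \<theta>"
    using M by (simp_all add: divide_simps) (simp_all add: algebra_simps)
  then show ?thesis
    unfolding N_def[symmetric] o2 cof(2) M_def[symmetric]
    by (simp add: vec_eq_iff forall_2 skew_def)
qed

lemma inv_coeff_eq:
  assumes \<theta>: "\<theta> \<in> euler_eq n m" and m: "max (i + j) 2 \<le> m" and n: "n \<ge> 2"
    and J: "J21 \<theta> \<noteq> 0" and D: "Delta2 \<theta> \<noteq> 0"
  shows "inv_coeff i j \<theta> = (2 / (of_nat n - 1)) ^ j * falling n i j * contr i \<theta>"
proof -
  define K where "K = i + j"
  define z :: complex where "z = 2 / (of_nat n - 1)"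
  define c where "c l = (if l \<le> K then z ^ (K - l) * falling n l (K - l) * contr l \<theta> else 0)" for l
  define C :: "complex^2^2" where "C = vector [vector [skew (snd \<theta>) $ 1, cx \<theta>], vector [skew (snd \<theta>) $ 2, cy \<theta>]]"
  have C: "column 1 C = skew (snd \<theta>)" "column 2 C = base \<theta>"
    by (simp_all add: C_def column_def vec_eq_iff forall_2)
  have p: "pull C (snd \<theta>) l (K - l) = falling n l (K - l) * contr l \<theta>" if "l \<le> K" for l
    unfolding pull_def C contr_def by (rule euler_pow_pow[OF \<theta>]) (use that m K_def in simp)
  have "Theta K \<theta> v = (\<Sum>l\<le>K. c l * (omega1 \<theta> v ^ l * omega2 \<theta> v ^ (K - l)) / (fact l * fact (K - l)))" for v
  proof -
    define e :: "complex^2" where "e = vector [omega1 \<theta> v, z * omega2 \<theta> v]"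
    have "C *v e = v"
      unfolding matrix_vector_columns C z_def e_def
      using euler_decomposition[OF \<theta> _ n J, of v] m by simp
    then have "fact K * Theta K \<theta> v = (ddir e ^^ K) (pull C (snd \<theta>)) 0 0"
      by (simp add: ddir_pow_pull ddir_pow_Theta)
    also have "\<dots> = (\<Sum>l\<le>K. of_nat (K choose l) * e$1 ^ l * e$2 ^ (K - l) * (falling n l (K - l) * contr l \<theta>))"
      unfolding ddir_pow_binomial by (intro sum.cong) (simp_all add: p)
    also have "\<dots> = fact K * (\<Sum>l\<le>K. c l * (omega1 \<theta> v ^ l * omega2 \<theta> v ^ (K - l)) / (fact l * fact (K - l)))"
      unfolding sum_distrib_left
      by (intro sum.cong refl) (simp add: c_def e_def binomial_fact power_mult_distrib field_simps)
    finally show ?thesis by simp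
  qed
  then have "coframe_coeffs K \<theta> c"
    by (auto simp: coframe_coeffs_def c_def)
  then have "(THE c. coframe_coeffs K \<theta> c) = c"
    by (rule the1_equality[OF ex1_coframe_coeffs[OF J D]])
  then show ?thesis
    by (simp add: inv_coeff_def K_def[symmetric]) (simp add: c_def K_def z_def)
qed

lemma nonvanishing_J21_Delta2:
  assumes "n \<ge> 2" "k \<ge> 2"
  shows "nonvanishing n k J21" "nonvanishing n k Delta2"
proof -
  let ?\<theta> = "sigma n k (\<lambda>b. if b = 1 then 0 else 1)"
  have f: "falling n 0 2 = of_nat n * (of_nat n - 1)" "falling n 0 (Suc 0) = of_nat n"
    by (simp_all add: falling_def numeral_2_eq_2)
  have "(of_nat n :: complex) \<noteq> of_nat 1" unfolding of_nat_eq_iff using assms by simp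
  then have "J21 ?\<theta> \<noteq> 0" "Delta2 ?\<theta> \<noteq> 0"
    using assms by (auto simp: J21_def Delta2_def sigma_def f)
  moreover have "J21 \<in> jet_polys k" "Delta2 \<in> jet_polys k"
    using assms(2) unfolding J21_def[abs_def] Delta2_def[abs_def] jet_polys_def
    by (intro generated_algebra_closed jet_polys_intros[unfolded jet_polys_def]; simp)+
  ultimately show "nonvanishing n k J21" "nonvanishing n k Delta2"
    using sigma_euler unfolding nonvanishing_def by blast+
qed

lemma euler_contr_normal_form:
  assumes \<theta>: "\<theta> \<in> euler_eq n m" and m: "m \<ge> 1" "k \<le> m" and n: "n \<ge> 1" and u: "cu 0 0 \<theta> \<noteq> 0"
  shows "\<exists>A. det A = 1 \<and>
    prolong k A (trunc k \<theta>) = sigma n k (\<lambda>b. (- 1 / (of_nat n * cu 0 0 \<theta>)) ^ b * contr b \<theta>)"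
proof -
  define s where "s = - 1 / (of_nat n * cu 0 0 \<theta>)"
  define B :: "complex^2^2" where
    "B = vector [vector [cx \<theta>, s * skew (snd \<theta>) $ 1], vector [cy \<theta>, s * skew (snd \<theta>) $ 2]]"
  have B: "column 1 B = base \<theta>" "column 2 B = s *s skew (snd \<theta>)"
    by (simp_all add: B_def column_def vec_eq_iff forall_2)
  have e: "of_nat n * cu 0 0 \<theta> = cx \<theta> * cu 1 0 \<theta> + cy \<theta> * cu 0 1 \<theta>"
    using euler_pow[OF \<theta>, of 0 0 1] m by (simp add: ddir_def falling_def)
  have "det B = - s * (of_nat n * cu 0 0 \<theta>)"
    unfolding e by (simp add: B_def det_2 skew_def algebra_simps)
  then have dB: "det B = 1" using n u by (simp add: s_def)
  have inv: "adj2 B ** B = mat 1" using adj2_mult(2)[OF dB] .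
  let ?\<theta> = "trunc k \<theta>"
  have t: "?\<theta> \<in> euler_eq n k" by (rule trunc_euler[OF \<theta> m(2)])
  have pr: "prolong k (adj2 B) ?\<theta> = (vector [1, 0], pull B (snd ?\<theta>))"
  proof -
    have "B *v vector [1, 0] = base \<theta>" by (simp add: matrix_vector_columns B)
    then have "adj2 B *v base \<theta> = vector [1, 0]"
      using matrix_vector_mul_assoc[of "adj2 B" B "vector [1, 0]"] inv by simp
    then show ?thesis
      using prolong_eq[OF inv euler_eq_jet_space[OF t]] by (simp add: trunc_def)
  qed
  have "prolong k (adj2 B) ?\<theta> = sigma n k (\<lambda>b. cu 0 b (prolong k (adj2 B) ?\<theta>))"
    by (rule euler_eq_sigma[OF prolong_euler[OF inv t]]) (simp add: pr)
  also have "\<dots> = sigma n k (\<lambda>b. s ^ b * contr b \<theta>)"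
  proof (rule sigma_cong)
    fix b assume b: "b \<le> k"
    have "pull B (snd ?\<theta>) 0 b = pull B (snd \<theta>) 0 b"
      using pull_cong_scale[of 0 b "snd ?\<theta>" 1 "snd \<theta>" B] b by (simp add: trunc_def)
    then show "cu 0 b (prolong k (adj2 B) ?\<theta>) = s ^ b * contr b \<theta>"
      by (simp add: pr pull_def B ddir_pow_scale contr_def)
  qed
  finally show ?thesis using dB unfolding s_def by (intro exI[of _ "adj2 B"]) simp
qed

section \<open>The field of invariants\<close>

lemma inv_coeff_rational_invariant:
  assumes n: "n \<ge> 2"
  shows "\<exists>F. rational_invariant n (i + j) F \<and>
    rat_eq n (max (i + j) 2) (inv_coeff i j) (F \<circ> trunc (i + j))"
proof -
  define F where "F \<theta> = ((2 / (of_nat n - 1)) ^ j * falling n i j) * contr i \<theta>" for \<theta>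
  have F: "F \<in> jet_polys (i + j)"
    using contr_jet_polys[of i j] unfolding F_def[abs_def] jet_polys_def by (rule generated_algebra_cmult)
  have "rational_on n (i + j) F"
    unfolding rational_on_def rat_eq_iff_nonvanishing
    using F nonvanishing_const[of 1 n "i + j"]
    by (intro bexI[of _ F] bexI[of _ "\<lambda>_. 1"] conjI exI[of _ "\<lambda>_. 1"]) (auto simp: nonvanishing_def)
  moreover have "rat_eq n (i + j) (F \<circ> prolong (i + j) A) F" if "det A = 1" for A
    unfolding rat_eq_iff_nonvanishing
    using contr_prolong[OF that] nonvanishing_const[of 1 n "i + j"]
    by (intro exI[of _ "\<lambda>_. 1"]) (simp add: F_def)
  ultimately have "rational_invariant n (i + j) F" by (simp add: rational_invariant_def)
  moreover have "rat_eq n (max (i + j) 2) (inv_coeff i j) (F \<circ> trunc (i + j))"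
    unfolding rat_eq_iff_nonvanishing
    using nonvanishing_mult[OF nonvanishing_J21_Delta2[OF n, of "max (i + j) 2"]]
    by (intro exI[of _ "\<lambda>\<theta>. J21 \<theta> * Delta2 \<theta>"])
       (simp add: jet_polys_trunc[OF contr_jet_polys] inv_coeff_eq n F_def)
  ultimately show ?thesis by blast
qed

lemma inv_coeff_generate:
  assumes n: "n \<ge> 2" and F: "rational_invariant n k F"
  defines "m \<equiv> max k 2"
  defines "G \<equiv> generated_algebra {inv_coeff i j |i j. i + j \<le> m}"
  shows "\<exists>P\<in>G. \<exists>Q\<in>G. \<not> rat_eq n m Q (\<lambda>_. 0) \<and> rat_eq n m (F \<circ> trunc k) (\<lambda>\<theta>. P \<theta> / Q \<theta>)"
proof -
  note split_paired_All [simp del] split_paired_Ex [simp del]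
  have m: "m \<ge> 2" "k \<le> m" by (simp_all add: m_def)
  from F obtain P Q where PQ: "P \<in> jet_polys k" "nonvanishing n k Q" "rat_eq n k F (\<lambda>\<theta>. P \<theta> / Q \<theta>)"
    unfolding rational_invariant_def rational_on_def nonvanishing_def by blast
  have Q: "Q \<in> jet_polys k" using PQ(2) by (simp add: nonvanishing_def)
  have cross: "P (prolong k A \<theta>) * Q \<theta> = P \<theta> * Q (prolong k A \<theta>)"
    if "det A = 1" "\<theta> \<in> euler_eq n k" for A \<theta>
    using invariant_cross_identity[OF that(1) _ PQ that(2)] F that(1) by (simp add: rational_invariant_def)
  obtain D where D: "nonvanishing n k D" "\<And>\<theta>. \<theta> \<in> euler_eq n k \<Longrightarrow> D \<theta> \<noteq> 0 \<Longrightarrow> F \<theta> = P \<theta> / Q \<theta>"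
    using PQ(3) by (auto simp: rat_eq_iff_nonvanishing)
  define S where "S = {\<theta> \<in> euler_eq n m. J21 \<theta> \<noteq> 0 \<and> Delta2 \<theta> \<noteq> 0}"
  have u0: "cu 0 0 \<theta> \<noteq> 0" if "\<theta> \<in> S" for \<theta>
    using that euler_coframe(1)[OF _ m(1) n, of \<theta>] by (simp add: S_def)
  have nvS: "nonvanishing n m (\<lambda>\<theta>. J21 \<theta> * Delta2 \<theta>)"
    by (rule nonvanishing_mult[OF nonvanishing_J21_Delta2[OF n m(1)]])
  define c where "c \<theta> b = (- 1 / (of_nat n * cu 0 0 \<theta>)) ^ b * contr b \<theta>" for \<theta> b
  have normal: "\<exists>A. det A = 1 \<and> prolong k A (trunc k \<theta>) = sigma n k (c \<theta>)" if "\<theta> \<in> S" for \<theta>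
    unfolding c_def[abs_def]
    by (rule euler_contr_normal_form[of _ n m]) (use that u0 m n S_def in auto)
  obtain \<theta>0 where \<theta>0: "\<theta>0 \<in> S" "Q \<theta>0 \<noteq> 0"
    using nonvanishing_mult[OF nonvanishing_lift[OF PQ(2) m(2)] nvS]
    unfolding nonvanishing_def S_def by auto
  obtain A0 where A0: "det A0 = 1" "prolong k A0 (trunc k \<theta>0) = sigma n k (c \<theta>0)"
    using normal[OF \<theta>0(1)] by blast
  define \<phi> where "\<phi> \<theta> = (adj2 A0 *v vector [1, 0], pull A0 (snd (sigma n k (c \<theta>))))" for \<theta>
  have \<phi>_orbit: "\<exists>A. det A = 1 \<and> \<phi> \<theta> = prolong k A (trunc k \<theta>)" if \<theta>: "\<theta> \<in> S" for \<theta>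
  proof -
    obtain A where A: "det A = 1" "prolong k A (trunc k \<theta>) = sigma n k (c \<theta>)"
      using normal[OF \<theta>] by blast
    have "\<phi> \<theta> = prolong k (adj2 A0) (sigma n k (c \<theta>))"
      using prolong_eq[OF adj2_mult(2)[OF A0(1)] euler_eq_jet_space[OF sigma_euler[of n k "c \<theta>"]]]
      by (simp add: \<phi>_def sigma_def)
    also have "\<dots> = prolong k (adj2 A0 ** A) (trunc k \<theta>)"
      unfolding A(2)[symmetric]
      by (rule prolong_prolong[OF adj2_mult(1)[OF A(1)] adj2_mult(2)[OF A0(1)] trunc_euler[of _ n, OF _ m(2)]])
         (use \<theta> in \<open>simp add: S_def\<close>)
    finally show ?thesis using A A0 by (intro exI[of _ "adj2 A0 ** A"]) (simp add: det_mul)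
  qed
  have "\<phi> \<theta>0 = trunc k \<theta>0"
  proof -
    have t: "trunc k \<theta>0 \<in> euler_eq n k" using trunc_euler[OF _ m(2)] \<theta>0(1) unfolding S_def by blast
    have "\<phi> \<theta>0 = prolong k (adj2 A0) (prolong k A0 (trunc k \<theta>0))"
      unfolding A0(2)
      using prolong_eq[OF adj2_mult(2)[OF A0(1)] euler_eq_jet_space[OF sigma_euler[of n k "c \<theta>0"]]]
      by (simp add: \<phi>_def sigma_def)
    then show ?thesis
      using prolong_prolong[OF adj2_mult(1)[OF A0(1)] adj2_mult(2)[OF A0(1)] t] prolong_mat_1[OF t]
      by (simp add: adj2_mult(2)[OF A0(1)])
  qed
  then have Q0: "Q (\<phi> \<theta>0) \<noteq> 0" using \<theta>0(2) jet_polys_trunc[OF Q] by simp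
  have clear: "\<exists>M. \<exists>R\<in>generated_algebra H. \<forall>\<theta>\<in>S. T \<theta> ^ M * f (\<phi> \<theta>) = R \<theta>"
    if f: "f \<in> jet_polys k" and T: "T \<in> generated_algebra H" "\<And>\<theta>. \<theta> \<in> S \<Longrightarrow> T \<theta> = cu 0 0 \<theta>"
      and h: "\<And>b. b \<le> k \<Longrightarrow> \<exists>h\<in>generated_algebra H. \<forall>\<theta>\<in>S. h \<theta> = contr b \<theta>"
    for f T and H :: "(jet \<Rightarrow> complex) set"
  proof (rule clear_denominators[OF T(1) _ f[unfolded jet_polys_def]])
    fix g assume "g \<in> {cx, cy} \<union> {cu i j |i j. i + j \<le> k}"
    then consider a where "\<forall>\<theta>. g (\<phi> \<theta>) = a" | i j where "g = cu i j" "i + j \<le> k"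
      by (auto simp: \<phi>_def)
    then show "\<exists>M. \<exists>R\<in>generated_algebra H. \<forall>\<theta>\<in>S. T \<theta> ^ M * g (\<phi> \<theta>) = R \<theta>"
    proof cases
      case 1
      then show ?thesis
        by (intro exI[of _ 0] bexI[OF _ generated_algebra.const[of a]]) simp
    next
      case 2
      have "\<forall>b. \<exists>f. b \<le> k \<longrightarrow> f \<in> generated_algebra H \<and> (\<forall>\<theta>\<in>S. f \<theta> = contr b \<theta>)"
        using h by blast
      then obtain f where "\<forall>b. b \<le> k \<longrightarrow> f b \<in> generated_algebra H \<and> (\<forall>\<theta>\<in>S. f b \<theta> = contr b \<theta>)"
        by (rule choice[THEN exE])
      then have h: "\<And>b. b \<le> k \<Longrightarrow> f b \<in> generated_algebra H"
        "\<And>b \<theta>. b \<le> k \<Longrightarrow> \<theta> \<in> S \<Longrightarrow> f b \<theta> = contr b \<theta>" by blast+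
      define r where "r \<theta> a b = (if a + b \<le> k then falling n b a * ((- 1 / of_nat n) ^ b * (T \<theta> ^ (k - b) * f b \<theta>)) else 0)"
        for \<theta> a b
      have "(\<lambda>\<theta>. r \<theta> a b) \<in> generated_algebra H" for a b
        using h(1)[of b] T(1) unfolding r_def
        by (cases "a + b \<le> k") (simp_all add: generated_algebra.const, intro generated_algebra_closed)
      then have R: "(\<lambda>\<theta>. pull A0 (r \<theta>) i j) \<in> generated_algebra H"
        by (intro generated_algebra_pull generated_algebra.const)
      have "pull A0 (r \<theta>) i j = T \<theta> ^ k * g (\<phi> \<theta>)" if \<theta>: "\<theta> \<in> S" for \<theta>
        unfolding 2(1) \<phi>_def snd_conv
      proof (rule pull_cong_scale)
        fix a b assume "a + b = i + j"
        then have ab: "a + b \<le> k" using 2 by simp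
        have "T \<theta> ^ k = T \<theta> ^ (k - b) * T \<theta> ^ b"
          using ab by (simp add: power_add[symmetric])
        moreover have "(- 1 / of_nat n) ^ b = cu 0 0 \<theta> ^ b * (- 1 / (of_nat n * cu 0 0 \<theta>)) ^ b"
          using u0[OF \<theta>] by (simp add: power_mult_distrib[symmetric])
        ultimately show "r \<theta> a b = T \<theta> ^ k * snd (sigma n k (c \<theta>)) a b"
          using ab h(2)[of b \<theta>] \<theta> by (simp add: r_def sigma_def c_def T(2)[OF \<theta>])
      qed
      then show ?thesis by (intro exI[of _ k] bexI[OF _ R]) simp
    qed
  qed
  have inv: "inv_coeff i 0 \<theta> = contr i \<theta>" if "\<theta> \<in> S" "i \<le> m" for i \<theta>
    using inv_coeff_eq[of \<theta> n m i 0] that m n by (simp add: S_def)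
  have I: "inv_coeff i 0 \<in> G" if "i \<le> m" for i
    using that unfolding G_def by (intro generated_algebra.gen CollectI exI[of _ i] exI[of _ 0]) simp
  have clear_G: "\<exists>M. \<exists>R\<in>G. \<forall>\<theta>\<in>S. inv_coeff 0 0 \<theta> ^ M * f (\<phi> \<theta>) = R \<theta>" if "f \<in> jet_polys k" for f
    unfolding G_def
  proof (rule clear[OF that])
    show "inv_coeff 0 0 \<in> generated_algebra {inv_coeff i j |i j. i + j \<le> m}"
      using I[of 0] unfolding G_def by simp
    show "inv_coeff 0 0 \<theta> = cu 0 0 \<theta>" if "\<theta> \<in> S" for \<theta>
      using inv[OF that, of 0] by simp
    show "\<exists>h\<in>generated_algebra {inv_coeff i j |i j. i + j \<le> m}. \<forall>\<theta>\<in>S. h \<theta> = contr b \<theta>" if "b \<le> k" for b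
      using I[of b] inv[of _ b] that m(2) unfolding G_def by (intro bexI[of _ "inv_coeff b 0"]) auto
  qed
  obtain M R where R: "R \<in> G" "\<And>\<theta>. \<theta> \<in> S \<Longrightarrow> inv_coeff 0 0 \<theta> ^ M * P (\<phi> \<theta>) = R \<theta>"
    using clear_G[OF PQ(1)] by blast
  obtain M' R' where R': "R' \<in> G" "\<And>\<theta>. \<theta> \<in> S \<Longrightarrow> inv_coeff 0 0 \<theta> ^ M' * Q (\<phi> \<theta>) = R' \<theta>"
    using clear_G[OF Q] by blast
  have "\<exists>M. \<exists>R\<in>jet_polys m. \<forall>\<theta>\<in>S. cu 0 0 \<theta> ^ M * Q (\<phi> \<theta>) = R \<theta>"
    unfolding jet_polys_def
  proof (rule clear[OF Q, where T = "cu 0 0"], fold jet_polys_def)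
    show "cu 0 0 \<in> jet_polys m" by (rule jet_polys_intros) simp
    show "\<exists>h\<in>jet_polys m. \<forall>\<theta>\<in>S. h \<theta> = contr b \<theta>" if "b \<le> k" for b
      using contr_jet_polys[of b "m - b"] that m(2) by (intro bexI[of _ "contr b"]) auto
  qed simp
  then obtain M'' E where E: "E \<in> jet_polys m" "\<And>\<theta>. \<theta> \<in> S \<Longrightarrow> cu 0 0 \<theta> ^ M'' * Q (\<phi> \<theta>) = E \<theta>"
    by blast
  have "E \<theta>0 \<noteq> 0" using E(2)[OF \<theta>0(1)] Q0 u0[OF \<theta>0(1)] by auto
  then have nvE: "nonvanishing n m E" using E(1) \<theta>0(1) by (auto simp: nonvanishing_def S_def)
  define D' where "D' \<theta> = (J21 \<theta> * Delta2 \<theta>) * (E \<theta> * (D \<theta> * Q \<theta>))" for \<theta>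
  have nvD': "nonvanishing n m D'"
    unfolding D'_def[abs_def]
    by (rule nonvanishing_mult[OF nvS nonvanishing_mult[OF nvE
          nonvanishing_mult[OF nonvanishing_lift[OF D(1) m(2)] nonvanishing_lift[OF PQ(2) m(2)]]]])
  define P1 where "P1 \<theta> = inv_coeff 0 0 \<theta> ^ M' * R \<theta>" for \<theta>
  define Q1 where "Q1 \<theta> = inv_coeff 0 0 \<theta> ^ M * R' \<theta>" for \<theta>
  have G: "P1 \<in> G" "Q1 \<in> G"
    using I[of 0] R(1) R'(1) unfolding P1_def[abs_def] Q1_def[abs_def] G_def
    by (auto intro!: generated_algebra_closed)
  have key: "Q1 \<theta> \<noteq> 0 \<and> F (trunc k \<theta>) = P1 \<theta> / Q1 \<theta>" if \<theta>: "\<theta> \<in> euler_eq n m" "D' \<theta> \<noteq> 0" for \<theta>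
  proof -
    have S: "\<theta> \<in> S" using \<theta> by (simp add: S_def D'_def)
    have nz: "D \<theta> \<noteq> 0" "Q \<theta> \<noteq> 0" "Q (\<phi> \<theta>) \<noteq> 0"
      using \<theta>(2) E(2)[OF S] by (auto simp: D'_def)
    have I0: "inv_coeff 0 0 \<theta> \<noteq> 0" using inv[OF S, of 0] u0[OF S] by simp
    have t: "trunc k \<theta> \<in> euler_eq n k" by (rule trunc_euler[OF \<theta>(1) m(2)])
    obtain A where "det A = 1" "\<phi> \<theta> = prolong k A (trunc k \<theta>)" using \<phi>_orbit[OF S] by blast
    then have "P (\<phi> \<theta>) * Q \<theta> = P \<theta> * Q (\<phi> \<theta>)"
      using cross[OF _ t] jet_polys_trunc[OF PQ(1)] jet_polys_trunc[OF Q] by simp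
    then have "P \<theta> / Q \<theta> = P (\<phi> \<theta>) / Q (\<phi> \<theta>)" using nz by (simp add: field_simps)
    moreover have "F (trunc k \<theta>) = P \<theta> / Q \<theta>"
      using D(2)[OF t] D(1) nz jet_polys_trunc[OF PQ(1)] jet_polys_trunc[OF Q] jet_polys_trunc[of D k]
      by (simp add: nonvanishing_def)
    ultimately show ?thesis
      using nz I0 by (simp add: P1_def Q1_def R(2)[OF S, symmetric] R'(2)[OF S, symmetric])
  qed
  have "\<not> rat_eq n m Q1 (\<lambda>_. 0)"
  proof
    assume "rat_eq n m Q1 (\<lambda>_. 0)"
    then obtain X where X: "nonvanishing n m X" "\<And>\<theta>. \<theta> \<in> euler_eq n m \<Longrightarrow> X \<theta> \<noteq> 0 \<Longrightarrow> Q1 \<theta> = 0"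
      by (auto simp: rat_eq_iff_nonvanishing)
    from nonvanishing_mult[OF X(1) nvD'] show False
      using X(2) key unfolding nonvanishing_def by auto
  qed
  moreover have "rat_eq n m (F \<circ> trunc k) (\<lambda>\<theta>. P1 \<theta> / Q1 \<theta>)"
    using nvD' key by (auto simp: rat_eq_iff_nonvanishing)
  ultimately show ?thesis using G by blast
qed

theorem theorem10:
  fixes n :: nat
  assumes "n \<ge> 2"
  shows
    "(\<forall>i j. \<exists>F. rational_invariant n (i + j) F \<and>
        rat_eq n (max (i + j) 2) (inv_coeff i j) (F \<circ> trunc (i + j))) \<and>
     (\<forall>k F. rational_invariant n k F \<longrightarrow>
        (\<exists>m \<ge> max k 2.
         \<exists>P \<in> generated_algebra {inv_coeff i j | i j. i + j \<le> m}.
         \<exists>Q \<in> generated_algebra {inv_coeff i j | i j. i + j \<le> m}.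
           \<not> rat_eq n m Q (\<lambda>_. 0) \<and>
           rat_eq n m (F \<circ> trunc k) (\<lambda>\<theta>. P \<theta> / Q \<theta>)))"
proof (intro conjI allI impI)
  show "\<exists>F. rational_invariant n (i + j) F \<and>
      rat_eq n (max (i + j) 2) (inv_coeff i j) (F \<circ> trunc (i + j))" for i j
    by (rule inv_coeff_rational_invariant[OF assms])
  show "\<exists>m \<ge> max k 2.
      \<exists>P \<in> generated_algebra {inv_coeff i j | i j. i + j \<le> m}.
      \<exists>Q \<in> generated_algebra {inv_coeff i j | i j. i + j \<le> m}.
        \<not> rat_eq n m Q (\<lambda>_. 0) \<and> rat_eq n m (F \<circ> trunc k) (\<lambda>\<theta>. P \<theta> / Q \<theta>)"
    if "rational_invariant n k F" for k F
    using inv_coeff_generate[OF assms that] by blast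
qed

end
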